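(* Let $\boldsymbol f\in\mathcal V^*$, $\boldsymbol u_0\in\boldsymbol H$, and let $\psi$ satisfy (i)–(iv) of the context. Consider the following two problems. Problem (P): find $\boldsymbol u\in\mathcal W$ and $p\in\mathcal Q$ such that for a.e. $t\in(0,T)$, $$\langle \boldsymbol u'(t),\boldsymbol v\rangle_{\boldsymbol V^*\times\boldsymbol V}+a(\boldsymbol u(t),\boldsymbol v)-b(\boldsymbol v,p(t))+\int_{\Gamma_S}\psi^0(\boldsymbol x,t,\boldsymbol u_\tau(t);\boldsymbol v_\tau)\,ds\ \ge\ \langle\boldsymbol f(t),\boldsymbol v\rangle_{\boldsymbol V^*\times\boldsymbol V}\quad\forall\,\boldsymbol v\in\boldsymbol V,$$ $b(\boldsymbol u(t),q)=0$ for all $q\in Q$, and $\boldsymbol u(0)=\boldsymbol u_0$. Problem (P'): find $\boldsymbol u\in\mathcal W$ and $p\in\mathcal Q$ such that for a.e. $t\in(0,T)$, $$\langle \boldsymbol u'(t),\boldsymbol v\rangle_{\boldsymbol V^*\times\boldsymbol V}+a(\boldsymbol u(t),\boldsymbol v)-b(\boldsymbol v,p(t))+\Psi^0(t,\gamma\boldsymbol u(t);\gamma\boldsymbol v)\ \ge\ \langle\boldsymbol f(t),\boldsymbol v\rangle_{\boldsymbol V^*\times\boldsymbol V}\quad\forall\,\boldsymbol v\in\boldsymbol V,$$ $b(\boldsymbol u(t),q)=0$ for all $q\in Q$, and $\boldsymbol u(0)=\boldsymbol u_0$. Then any solution of Problem (P') is a solution of Problem (P). If Problem (P') has a solution and a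 solution of Problem (P) is unique (i.e. Problem (P) has at most one solution), then both problems admit a unique solution, and the solution is the same for the two problems.
   Context: Domain: $d\in\{2,3\}$; $\Omega\subset\mathbb R^d$ is a bounded Lipschitz domain with boundary $\Gamma=\Gamma_D\cup\Gamma_S$, where $\Gamma_D$ (relatively closed) and $\Gamma_S$ (relatively open) are disjoint and of positive surface measure; $T>0$; $\mu>0$ is a constant. $\boldsymbol\nu$ is the unit outward normal on $\Gamma$; for a vector field $\boldsymbol v$, $v_\nu=\boldsymbol v\cdot\boldsymbol\nu$ and $\boldsymbol v_\tau=\boldsymbol v-v_\nu\boldsymbol\nu$ on $\Gamma$ (in the sense of traces). $\boldsymbol\varepsilon(\boldsymbol v)=(\nabla\boldsymbol v+(\nabla\boldsymbol v)^T)/2$. Spaces: $\boldsymbol V=\{\boldsymbol v\in H^1(\Omega)^d\mid \boldsymbol v=\boldsymbol 0\text{ on }\Gamma_D,\ v_\nu=0\text{ on }\Gamma_S\}$ with inner product $(\boldsymbol u,\boldsymbol v)_{\boldsymbol V}=\int_\Omega\boldsymbol\varepsilon(\boldsymbol u):\boldsymbol\varepsilon(\boldsymbol v)\,dx$ (a Hilbert space, with norm equivalent to the $H^1$ norm by Korn's inequality); $\boldsymbol H=L^2(\Omega)^d$, identified with its dual so that $\boldsymbol V\subset\boldsymbol H\subset\boldsymbol V^*$; $Q=\{q\in L^2(\Omega)\mid\int_\Omega q\,dx=0\}$; $\mathcal V=L^2(0,T;\boldsymbol V)$, $\mathcal V^*=L^2(0,T;\boldsymbol V^* )$; $\mathcal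 W=\{\boldsymbol v\in\mathcal V\mid\boldsymbol v'\in\mathcal V^*\}$, with $\boldsymbol v'$ the generalized time derivative (so $\mathcal W\subset C([0,T];\boldsymbol H)$ and $\boldsymbol u(0)$ is meaningful); $\mathcal Q=L^2(0,T;Q)$; $\boldsymbol S=L^2(\Gamma_S)^d$. Forms and trace: $a(\boldsymbol u,\boldsymbol v)=2\mu\int_\Omega\boldsymbol\varepsilon(\boldsymbol u):\boldsymbol\varepsilon(\boldsymbol v)\,dx$; $b(\boldsymbol v,q)=\int_\Omega q\,\mathrm{div}\,\boldsymbol v\,dx$; $\gamma:\boldsymbol V\to\boldsymbol S$, $\gamma\boldsymbol v=\boldsymbol v_\tau|_{\Gamma_S}$. Clarke calculus: for a locally Lipschitz $\Phi:X\to\mathbb R$ on a Banach space $X$, $\Phi^0(u;v)=\limsup_{w\to u,\ \lambda\downarrow0}\frac{\Phi(w+\lambda v)-\Phi(w)}{\lambda}$ and $\partial\Phi(u)=\{\xi\in X^*\mid\Phi^0(u;v)\ge\langle\xi,v\rangle\ \forall v\in X\}$. For $\psi$, $\psi^0(\boldsymbol x,t,\boldsymbol\xi;\boldsymbol\eta)$ and $\partial\psi(\boldsymbol x,t,\boldsymbol\xi)$ are taken with respect to the last variable $\boldsymbol\xi\in\mathbb R^d$. Conditions on $\psi:\Gamma_S\times(0,T)\times\mathbb R^d\to\mathbb R$: (i) $\psi(\cdot,\cdot,\boldsymbol\xi)$ is measurable on $\Gamma_S\times(0,T)$ for all $\boldsymbol\xi\in\mathbb R^d$, and there is $\boldsymbol\xi_0\in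 L^2(\Gamma_S)^d$ with $\psi(\cdot,t,\boldsymbol\xi_0(\cdot))\in L^1(\Gamma_S)$ for a.e. $t\in(0,T)$; (ii) $\psi(\boldsymbol x,t,\cdot)$ is locally Lipschitz on $\mathbb R^d$ for a.e. $(\boldsymbol x,t)$; (iii) there is $c_0>0$ with $|\boldsymbol\eta|\le c_0(1+|\boldsymbol\xi|)$ for all $\boldsymbol\xi\in\mathbb R^d$, $\boldsymbol\eta\in\partial\psi(\boldsymbol x,t,\boldsymbol\xi)$, a.e. $(\boldsymbol x,t)$; (iv) there is a constant $\alpha_\psi>0$ with $(\boldsymbol\eta_1-\boldsymbol\eta_2)\cdot(\boldsymbol\xi_1-\boldsymbol\xi_2)\ge-\alpha_\psi|\boldsymbol\xi_1-\boldsymbol\xi_2|^2$ for all $\boldsymbol\xi_i\in\mathbb R^d$, $\boldsymbol\eta_i\in\partial\psi(\boldsymbol x,t,\boldsymbol\xi_i)$, $i=1,2$, a.e. $(\boldsymbol x,t)$. Functional: $\Psi(t,\boldsymbol z)=\int_{\Gamma_S}\psi(\boldsymbol x,t,\boldsymbol z(\boldsymbol x))\,ds$ for $\boldsymbol z\in\boldsymbol S$, and $\Psi^0(t,\boldsymbol z;\boldsymbol w)$ is its Clarke generalized directional derivative with respect to $\boldsymbol z$ in the direction $\boldsymbol w$. *)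

theory Defs
  imports "HOL-Analysis.Analysis"
begin

section \<open>Surface measure\<close>

text \<open>
  The surface measure on boundaries in \<open>\<real>\<^sup>d\<close> is the Hausdorff measure of dimension \<open>s = d - 1\<close>,
  normalised by the factor \<open>\<omega>\<^sub>s / 2\<^sup>s\<close> (\<open>\<omega>\<^sub>s\<close> the volume of the unit ball of \<open>\<real>\<^sup>s\<close>) and taken on all
  Caratheodory-measurable sets, hence complete. It is used for \<open>d \<ge> 2\<close> only, so that the empty
  set contributes \<open>0\<^sup>s = 0\<close> to the sums.
\<close>

definition hausdorff_content :: "nat \<Rightarrow> real \<Rightarrow> 'a::metric_space set \<Rightarrow> ennreal" where
  "hausdorff_content s \<delta> A =
     Inf {(\<Sum>n. ennreal (unit_ball_vol (real s) * (diameter (C n) / 2) ^ s)) | C :: nat \<Rightarrow> 'a set.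
            A \<subseteq> (\<Union>n. C n) \<and> (\<forall>n. bounded (C n) \<and> diameter (C n) \<le> \<delta>)}"

definition hausdorff_outer :: "nat \<Rightarrow> 'a::metric_space set \<Rightarrow> ennreal" where
  "hausdorff_outer s A = (SUP \<delta>\<in>{0<..}. hausdorff_content s \<delta> A)"

definition surface_measure :: "(real^'n) measure" where
  "surface_measure =
     (let H = hausdorff_outer (CARD('n) - 1)
      in measure_of UNIV (lambda_system UNIV UNIV H) H)"

definition surface_on :: "(real^'n) set \<Rightarrow> (real^'n) measure" where
  "surface_on A = restrict_space surface_measure A"

text \<open>
  By Caratheodory's theorem the triple given to \<open>measure_of\<close> is a measure space, so that
  \<open>surface_measure\<close> is the Hausdorff measure and not the zero default of \<open>measure_of\<close>.
\<close>

lemma hausdorff_content_subadd: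
  fixes A :: "nat \<Rightarrow> 'a::metric_space set"
  shows "hausdorff_content s \<delta> (\<Union>i. A i) \<le> (\<Sum>i. hausdorff_content s \<delta> (A i))"
proof (rule ennreal_le_epsilon)
  let ?H = "hausdorff_content s \<delta> :: 'a set \<Rightarrow> ennreal"
  let ?f = "\<lambda>C :: 'a set. ennreal (unit_ball_vol (real s) * (diameter C / 2) ^ s)"
  fix e :: real assume e: "0 < e" "(\<Sum>n. ?H (A n)) < top"
  then have *: "?H (A n) < ?H (A n) + e * (1/2)^Suc n" for n
    by (auto simp add: less_top dest!: ennreal_suminf_lessD)
  have "\<exists>C. A n \<subseteq> (\<Union>i. C i) \<and> (\<forall>i. bounded (C i) \<and> diameter (C i) \<le> \<delta>)
          \<and> (\<Sum>i. ?f (C i)) \<le> ?H (A n) + e * (1/2)^Suc n" for n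
    using *[of n] unfolding hausdorff_content_def[of s \<delta> "A n"] Inf_less_iff
    by (auto intro: less_imp_le)
  then obtain B where B: "\<And>n. A n \<subseteq> (\<Union>i::nat. B n i)"
      "\<And>n i. bounded (B n i) \<and> diameter (B n i) \<le> \<delta>"
      "\<And>n. (\<Sum>i. ?f (B n i)) \<le> ?H (A n) + e * (1/2)^Suc n"
    by metis
  define C where "C = case_prod B o prod_decode"
  have "(\<Union>i. A i) \<subseteq> (\<Union>i. C i)"
    using B(1) by (auto simp add: C_def subset_eq) (metis prod.case prod_encode_inverse)
  then have "?H (\<Union>i. A i) \<le> (\<Sum>i. ?f (C i))"
    unfolding hausdorff_content_def using B(2)
    by (intro Inf_lower) (auto simp: C_def split_def)
  also have "\<dots> = (\<Sum>n. \<Sum>i. ?f (B n i))"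
    using suminf_ennreal_2dimen[of "\<lambda>m. \<Sum>i. ?f (B m i)" "\<lambda>(m,n). ?f (B m n)"]
    by (simp add: C_def comp_def split_def)
  also have "\<dots> \<le> (\<Sum>n. ?H (A n) + e * (1/2) ^ Suc n)"
    by (intro suminf_le B) auto
  also have "... = (\<Sum>n. ?H (A n)) + (\<Sum>n. ennreal e * ennreal ((1/2) ^ Suc n))"
    using e by (subst suminf_add[symmetric])
       (auto simp del: ennreal_suminf_cmult simp add: ennreal_mult[symmetric])
  also have "\<dots> = (\<Sum>n. ?H (A n)) + e"
    unfolding ennreal_suminf_cmult
    by (subst suminf_ennreal_eq[OF zero_le_power power_half_series]) auto
  finally show "?H (\<Union>i. A i) \<le> (\<Sum>n. ?H (A n)) + e" .
qed

lemma outer_measure_space_hausdorff: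
  assumes "s > 0"
  shows "outer_measure_space UNIV (hausdorff_outer s :: 'a::metric_space set \<Rightarrow> ennreal)"
proof -
  have "hausdorff_content s \<delta> ({}::'a set) = 0" if "\<delta> > 0" for \<delta>
  proof -
    have "hausdorff_content s \<delta> ({}::'a set) \<le> (\<Sum>n::nat. ennreal 0)"
      unfolding hausdorff_content_def using assms that
      by (intro Inf_lower CollectI exI[of _ "\<lambda>_. {}"]) (auto simp: zero_power)
    then show ?thesis by simp
  qed
  then have "hausdorff_outer s ({}::'a set) = 0"
    by (simp add: hausdorff_outer_def)
  moreover have "hausdorff_outer s A \<le> hausdorff_outer s B" if "A \<subseteq> B" for A B :: "'a set"
    unfolding hausdorff_outer_def hausdorff_content_def using that
    by (intro SUP_mono' Inf_superset_mono) blast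
  moreover have "hausdorff_outer s (\<Union>i. A i) \<le> (\<Sum>i. hausdorff_outer s (A i))"
    for A :: "nat \<Rightarrow> 'a set"
    unfolding hausdorff_outer_def[of s "\<Union>i. A i"]
  proof (rule SUP_least)
    fix \<delta> :: real assume "\<delta> \<in> {0<..}"
    then have "(\<Sum>i. hausdorff_content s \<delta> (A i)) \<le> (\<Sum>i. hausdorff_outer s (A i))"
      by (intro suminf_le) (auto simp: hausdorff_outer_def intro: SUP_upper)
    with hausdorff_content_subadd[of s \<delta> A]
    show "hausdorff_content s \<delta> (\<Union>i. A i) \<le> (\<Sum>i. hausdorff_outer s (A i))"
      by (rule order_trans)
  qed
  ultimately show ?thesis
    by (auto simp: outer_measure_space_def positive_def increasing_def countably_subadditive_def)
qed

lemma surface_measure_facts: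
  assumes "CARD('n) \<ge> 2"
  shows "sets (surface_measure :: (real^'n) measure)
           = lambda_system UNIV UNIV (hausdorff_outer (CARD('n) - 1))"
    and "A \<in> sets (surface_measure :: (real^'n) measure) \<Longrightarrow>
           emeasure surface_measure A = hausdorff_outer (CARD('n) - 1) A"
proof -
  let ?H = "hausdorff_outer (CARD('n) - 1) :: (real^'n) set \<Rightarrow> ennreal"
  interpret sigma_algebra "UNIV :: (real^'n) set" UNIV
    using sigma_algebra_Pow[of UNIV] by simp
  have ms: "measure_space UNIV (lambda_system UNIV UNIV ?H) ?H"
    using assms by (intro caratheodory_lemma outer_measure_space_hausdorff) auto
  then interpret L: sigma_algebra UNIV "lambda_system UNIV UNIV ?H"
    by (simp add: measure_space_def)
  show s: "sets (surface_measure :: (real^'n) measure) = lambda_system UNIV UNIV ?H"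
    using L.sets_measure_of_eq by (simp add: surface_measure_def Let_def)
  show "emeasure surface_measure A = ?H A" if "A \<in> sets (surface_measure :: (real^'n) measure)"
    using ms that unfolding s
    by (simp add: surface_measure_def Let_def emeasure_measure_of_sigma measure_space_def)
qed


section \<open>Lipschitz domains and the outward normal\<close>

text \<open>
  Near each boundary point \<open>x\<close>, after a rigid motion taking \<open>e\<close> to the vertical direction, the set
  is the part of a cylinder lying above the graph of a Lipschitz function \<open>g\<close> on the
  hyperplane orthogonal to \<open>e\<close>.
\<close>

definition lipschitz_boundary :: "'a::euclidean_space set \<Rightarrow> bool" where
  "lipschitz_boundary \<Omega> \<longleftrightarrow>
     (\<forall>x\<in>frontier \<Omega>. \<exists>e r h L. \<exists>g :: 'a \<Rightarrow> real.
        norm e = 1 \<and> 0 < r \<and> 0 < h \<and> L-lipschitz_on {z. z \<bullet> e = 0} g \<and>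
        (\<forall>z. z \<bullet> e = 0 \<and> norm z < r \<longrightarrow> \<bar>g z\<bar> < h) \<and>
        (\<forall>z s. z \<bullet> e = 0 \<and> norm z < r \<and> \<bar>s\<bar> < h \<longrightarrow>
               (x + z + s *\<^sub>R e \<in> \<Omega> \<longleftrightarrow> g z < s)))"

definition bounded_lipschitz_domain :: "'a::euclidean_space set \<Rightarrow> bool" where
  "bounded_lipschitz_domain \<Omega> \<longleftrightarrow>
     open \<Omega> \<and> connected \<Omega> \<and> \<Omega> \<noteq> {} \<and> bounded \<Omega> \<and> lipschitz_boundary \<Omega>"

text \<open>
  A unit vector \<open>n\<close> is the outward normal at \<open>x\<close> if, near \<open>x\<close> and up to arbitrarily thin cones
  around the tangent hyperplane, \<open>\<Omega>\<close> is the half space \<open>{y. (y - x) \<bullet> n < 0}\<close>. For a Lipschitz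
  graph this is differentiability at \<open>x\<close>, which holds almost everywhere on the boundary; the value
  \<open>0\<close> elsewhere only serves to make the normal field total.
\<close>

definition is_outward_normal :: "'a::euclidean_space set \<Rightarrow> 'a \<Rightarrow> 'a \<Rightarrow> bool" where
  "is_outward_normal \<Omega> x n \<longleftrightarrow>
     norm n = 1 \<and>
     (\<forall>\<epsilon>>0. \<exists>\<delta>>0. \<forall>y. norm (y - x) < \<delta> \<longrightarrow>
        ((y - x) \<bullet> n < - \<epsilon> * norm (y - x) \<longrightarrow> y \<in> \<Omega>) \<and>
        ((y - x) \<bullet> n > \<epsilon> * norm (y - x) \<longrightarrow> y \<notin> \<Omega>))"

definition outward_normal :: "'a::euclidean_space set \<Rightarrow> 'a \<Rightarrow> 'a" where
  "outward_normal \<Omega> x =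
     (if \<exists>n. is_outward_normal \<Omega> x n then (THE n. is_outward_normal \<Omega> x n) else 0)"


section \<open>Lebesgue and Sobolev spaces\<close>

text \<open>
  Elements of function spaces are represented by functions, not by classes modulo null sets; the
  norms below are therefore seminorms on the representatives.
\<close>

definition L2 :: "'a measure \<Rightarrow> ('a \<Rightarrow> 'b::euclidean_space) set" where
  "L2 M = {f \<in> borel_measurable M. integrable M (\<lambda>x. (norm (f x))\<^sup>2)}"

definition L2_inner :: "'a measure \<Rightarrow> ('a \<Rightarrow> 'b::euclidean_space) \<Rightarrow> ('a \<Rightarrow> 'b) \<Rightarrow> real" where
  "L2_inner M f g = (\<integral>x. f x \<bullet> g x \<partial>M)"

definition L2_norm :: "'a measure \<Rightarrow> ('a \<Rightarrow> 'b::euclidean_space) \<Rightarrow> real" where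
  "L2_norm M f = sqrt (\<integral>x. (norm (f x))\<^sup>2 \<partial>M)"

coinductive smooth :: "('a::euclidean_space \<Rightarrow> 'b::real_normed_vector) \<Rightarrow> bool" where
  "\<lbrakk>\<And>x. f differentiable (at x);
    \<And>b. b \<in> Basis \<Longrightarrow> smooth (\<lambda>x. frechet_derivative f (at x) b)\<rbrakk> \<Longrightarrow> smooth f"

definition test_function :: "'a::euclidean_space set \<Rightarrow> ('a \<Rightarrow> real) \<Rightarrow> bool" where
  "test_function U \<phi> \<longleftrightarrow>
     smooth \<phi> \<and> compact (closure {x. \<phi> x \<noteq> 0}) \<and> closure {x. \<phi> x \<noteq> 0} \<subseteq> U"

text \<open>The entry \<open>G x $ i $ j\<close> of the weak gradient is the derivative of \<open>v\<^sub>i\<close> in direction \<open>j\<close>.\<close>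

definition is_weak_gradient ::
  "(real^'n) set \<Rightarrow> (real^'n \<Rightarrow> real^'n) \<Rightarrow> (real^'n \<Rightarrow> real^'n^'n) \<Rightarrow> bool" where
  "is_weak_gradient \<Omega> v G \<longleftrightarrow>
     (\<forall>\<phi> i j. test_function \<Omega> \<phi> \<longrightarrow>
        (\<integral>x. v x $ i * frechet_derivative \<phi> (at x) (axis j 1) \<partial>lebesgue_on \<Omega>)
          = - (\<integral>x. G x $ i $ j * \<phi> x \<partial>lebesgue_on \<Omega>))"

definition H1 :: "(real^'n) set \<Rightarrow> (real^'n \<Rightarrow> real^'n) set" where
  "H1 \<Omega> = {v \<in> L2 (lebesgue_on \<Omega>). \<exists>G \<in> L2 (lebesgue_on \<Omega>). is_weak_gradient \<Omega> v G}"

definition weak_gradient ::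
  "(real^'n) set \<Rightarrow> (real^'n \<Rightarrow> real^'n) \<Rightarrow> real^'n \<Rightarrow> real^'n^'n" where
  "weak_gradient \<Omega> v = (SOME G. G \<in> L2 (lebesgue_on \<Omega>) \<and> is_weak_gradient \<Omega> v G)"

definition strain :: "(real^'n) set \<Rightarrow> (real^'n \<Rightarrow> real^'n) \<Rightarrow> real^'n \<Rightarrow> real^'n^'n" where
  "strain \<Omega> v x = (1/2) *\<^sub>R (weak_gradient \<Omega> v x + transpose (weak_gradient \<Omega> v x))"

definition divergence :: "(real^'n) set \<Rightarrow> (real^'n \<Rightarrow> real^'n) \<Rightarrow> real^'n \<Rightarrow> real" where
  "divergence \<Omega> v x = trace (weak_gradient \<Omega> v x)"

text \<open>
  The trace operator on \<open>H\<^sup>1\<close> is the continuous extension of the restriction to the boundary of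
  functions that are smooth up to the boundary.
\<close>

definition has_boundary_trace ::
  "(real^'n) set \<Rightarrow> (real^'n \<Rightarrow> real^'n) \<Rightarrow> (real^'n \<Rightarrow> real^'n) \<Rightarrow> bool" where
  "has_boundary_trace \<Omega> v g \<longleftrightarrow>
     g \<in> L2 (surface_on (frontier \<Omega>)) \<and>
     (\<exists>\<phi>. (\<forall>n::nat. smooth (\<phi> n)) \<and>
        (\<lambda>n. L2_norm (lebesgue_on \<Omega>) (\<lambda>x. \<phi> n x - v x)) \<longlonglongrightarrow> 0 \<and>
        (\<lambda>n. L2_norm (lebesgue_on \<Omega>)
               (\<lambda>x. matrix (frechet_derivative (\<phi> n) (at x)) - weak_gradient \<Omega> v x)) \<longlonglongrightarrow> 0 \<and>
        (\<lambda>n. L2_norm (surface_on (frontier \<Omega>)) (\<lambda>x. \<phi> n x - g x)) \<longlonglongrightarrow> 0)"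

definition boundary_trace :: "(real^'n) set \<Rightarrow> (real^'n \<Rightarrow> real^'n) \<Rightarrow> real^'n \<Rightarrow> real^'n" where
  "boundary_trace \<Omega> v = (SOME g. has_boundary_trace \<Omega> v g)"

definition tangential_trace :: "(real^'n) set \<Rightarrow> (real^'n \<Rightarrow> real^'n) \<Rightarrow> real^'n \<Rightarrow> real^'n" where
  "tangential_trace \<Omega> v x =
     boundary_trace \<Omega> v x
       - (boundary_trace \<Omega> v x \<bullet> outward_normal \<Omega> x) *\<^sub>R outward_normal \<Omega> x"

definition V_space ::
  "(real^'n) set \<Rightarrow> (real^'n) set \<Rightarrow> (real^'n) set \<Rightarrow> (real^'n \<Rightarrow> real^'n) set" where
  "V_space \<Omega> \<Gamma>\<^sub>D \<Gamma>\<^sub>S =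
     {v \<in> H1 \<Omega>. \<exists>g. has_boundary_trace \<Omega> v g \<and>
        (AE x in surface_on \<Gamma>\<^sub>D. g x = 0) \<and>
        (AE x in surface_on \<Gamma>\<^sub>S. g x \<bullet> outward_normal \<Omega> x = 0)}"

definition V_inner ::
  "(real^'n) set \<Rightarrow> (real^'n \<Rightarrow> real^'n) \<Rightarrow> (real^'n \<Rightarrow> real^'n) \<Rightarrow> real" where
  "V_inner \<Omega> u v = (\<integral>x. strain \<Omega> u x \<bullet> strain \<Omega> v x \<partial>lebesgue_on \<Omega>)"

definition V_norm :: "(real^'n) set \<Rightarrow> (real^'n \<Rightarrow> real^'n) \<Rightarrow> real" where
  "V_norm \<Omega> v = sqrt (V_inner \<Omega> v v)"

definition Q_space :: "(real^'n) set \<Rightarrow> (real^'n \<Rightarrow> real) set" where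
  "Q_space \<Omega> = {q \<in> L2 (lebesgue_on \<Omega>). (\<integral>x. q x \<partial>lebesgue_on \<Omega>) = 0}"

definition form_a ::
  "(real^'n) set \<Rightarrow> real \<Rightarrow> (real^'n \<Rightarrow> real^'n) \<Rightarrow> (real^'n \<Rightarrow> real^'n) \<Rightarrow> real" where
  "form_a \<Omega> \<mu> u v = 2 * \<mu> * (\<integral>x. strain \<Omega> u x \<bullet> strain \<Omega> v x \<partial>lebesgue_on \<Omega>)"

definition form_b :: "(real^'n) set \<Rightarrow> (real^'n \<Rightarrow> real^'n) \<Rightarrow> (real^'n \<Rightarrow> real) \<Rightarrow> real" where
  "form_b \<Omega> v q = (\<integral>x. q x * divergence \<Omega> v x \<partial>lebesgue_on \<Omega>)"

definition dual_space :: "('a \<Rightarrow> 'b::real_vector) set \<Rightarrow> (('a \<Rightarrow> 'b) \<Rightarrow> real) \<Rightarrow> (('a \<Rightarrow> 'b) \<Rightarrow> real) set"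
  where
  "dual_space X N =
     {l. (\<forall>v\<in>X. \<forall>w\<in>X. l (\<lambda>x. v x + w x) = l v + l w) \<and>
         (\<forall>v\<in>X. \<forall>c. l (\<lambda>x. c *\<^sub>R v x) = c * l v) \<and>
         (\<exists>C. \<forall>v\<in>X. \<bar>l v\<bar> \<le> C * N v)}"

definition dual_norm :: "('a \<Rightarrow> 'b) set \<Rightarrow> (('a \<Rightarrow> 'b) \<Rightarrow> real) \<Rightarrow> (('a \<Rightarrow> 'b) \<Rightarrow> real) \<Rightarrow> real" where
  "dual_norm X N l = (SUP v\<in>{v\<in>X. N v \<le> 1}. \<bar>l v\<bar>)"


section \<open>Time-dependent functions\<close>

text \<open>
  The Bochner space \<open>L\<^sup>2(0,T;X)\<close>, for a space \<open>X\<close> of functions with seminorm \<open>N\<close>: strongly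
  measurable (an almost everywhere limit of simple functions), with square-integrable norm.
\<close>

definition bochner_L2 ::
  "real \<Rightarrow> ('a \<Rightarrow> 'b::real_vector) set \<Rightarrow> (('a \<Rightarrow> 'b) \<Rightarrow> real) \<Rightarrow> (real \<Rightarrow> 'a \<Rightarrow> 'b) set" where
  "bochner_L2 T X N =
     {f. (AE t in lebesgue_on {0<..<T}. f t \<in> X) \<and>
         (\<exists>s :: nat \<Rightarrow> real \<Rightarrow> 'a \<Rightarrow> 'b.
            (\<forall>n. simple_function (lebesgue_on {0<..<T}) (s n) \<and> (\<forall>t\<in>{0<..<T}. s n t \<in> X)) \<and>
            (AE t in lebesgue_on {0<..<T}. (\<lambda>n. N (\<lambda>x. f t x - s n t x)) \<longlonglongrightarrow> 0)) \<and>
         integrable (lebesgue_on {0<..<T}) (\<lambda>t. (N (f t))\<^sup>2)}"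

definition VV ::
  "(real^'n) set \<Rightarrow> (real^'n) set \<Rightarrow> (real^'n) set \<Rightarrow> real \<Rightarrow> (real \<Rightarrow> real^'n \<Rightarrow> real^'n) set" where
  "VV \<Omega> \<Gamma>\<^sub>D \<Gamma>\<^sub>S T = bochner_L2 T (V_space \<Omega> \<Gamma>\<^sub>D \<Gamma>\<^sub>S) (V_norm \<Omega>)"

definition VV_dual ::
  "(real^'n) set \<Rightarrow> (real^'n) set \<Rightarrow> (real^'n) set \<Rightarrow> real
     \<Rightarrow> (real \<Rightarrow> (real^'n \<Rightarrow> real^'n) \<Rightarrow> real) set" where
  "VV_dual \<Omega> \<Gamma>\<^sub>D \<Gamma>\<^sub>S T =
     bochner_L2 T (dual_space (V_space \<Omega> \<Gamma>\<^sub>D \<Gamma>\<^sub>S) (V_norm \<Omega>))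
                  (dual_norm (V_space \<Omega> \<Gamma>\<^sub>D \<Gamma>\<^sub>S) (V_norm \<Omega>))"

definition QQ :: "(real^'n) set \<Rightarrow> real \<Rightarrow> (real \<Rightarrow> real^'n \<Rightarrow> real) set" where
  "QQ \<Omega> T = bochner_L2 T (Q_space \<Omega>) (L2_norm (lebesgue_on \<Omega>))"

text \<open>
  \<open>u'\<close> is the distributional derivative of \<open>u\<close> with values in the dual of \<open>V\<close>, where \<open>u(t)\<close> acts on
  \<open>w\<close> through the inner product of \<open>H = L\<^sup>2(\<Omega>)\<^sup>d\<close>. The identity
  \<open>\<integral> u' \<phi> dt = - \<integral> u \<phi>' dt\<close> in the dual of \<open>V\<close> is written out by evaluating both sides at \<open>w\<close>.
\<close>

definition is_time_derivative ::
  "(real^'n) set \<Rightarrow> (real^'n) set \<Rightarrow> (real^'n) set \<Rightarrow> real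
     \<Rightarrow> (real \<Rightarrow> real^'n \<Rightarrow> real^'n) \<Rightarrow> (real \<Rightarrow> (real^'n \<Rightarrow> real^'n) \<Rightarrow> real) \<Rightarrow> bool" where
  "is_time_derivative \<Omega> \<Gamma>\<^sub>D \<Gamma>\<^sub>S T u u' \<longleftrightarrow>
     (\<forall>\<phi> w. test_function {0<..<T} \<phi> \<and> w \<in> V_space \<Omega> \<Gamma>\<^sub>D \<Gamma>\<^sub>S \<longrightarrow>
        (\<integral>t. u' t w * \<phi> t \<partial>lebesgue_on {0<..<T})
          = - (\<integral>t. L2_inner (lebesgue_on \<Omega>) (u t) w * deriv \<phi> t \<partial>lebesgue_on {0<..<T}))"

definition WW ::
  "(real^'n) set \<Rightarrow> (real^'n) set \<Rightarrow> (real^'n) set \<Rightarrow> real \<Rightarrow> (real \<Rightarrow> real^'n \<Rightarrow> real^'n) set" where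
  "WW \<Omega> \<Gamma>\<^sub>D \<Gamma>\<^sub>S T =
     {u \<in> VV \<Omega> \<Gamma>\<^sub>D \<Gamma>\<^sub>S T. \<exists>u' \<in> VV_dual \<Omega> \<Gamma>\<^sub>D \<Gamma>\<^sub>S T. is_time_derivative \<Omega> \<Gamma>\<^sub>D \<Gamma>\<^sub>S T u u'}"

definition time_derivative ::
  "(real^'n) set \<Rightarrow> (real^'n) set \<Rightarrow> (real^'n) set \<Rightarrow> real
     \<Rightarrow> (real \<Rightarrow> real^'n \<Rightarrow> real^'n) \<Rightarrow> real \<Rightarrow> (real^'n \<Rightarrow> real^'n) \<Rightarrow> real" where
  "time_derivative \<Omega> \<Gamma>\<^sub>D \<Gamma>\<^sub>S T u =
     (SOME u'. u' \<in> VV_dual \<Omega> \<Gamma>\<^sub>D \<Gamma>\<^sub>S T \<and> is_time_derivative \<Omega> \<Gamma>\<^sub>D \<Gamma>\<^sub>S T u u')"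

text \<open>\<open>u(0) = u\<^sub>0\<close> is understood for the representative of \<open>u\<close> in \<open>C([0,T];H)\<close>.\<close>

definition has_initial_value ::
  "(real^'n) set \<Rightarrow> real \<Rightarrow> (real \<Rightarrow> real^'n \<Rightarrow> real^'n) \<Rightarrow> (real^'n \<Rightarrow> real^'n) \<Rightarrow> bool" where
  "has_initial_value \<Omega> T u u\<^sub>0 \<longleftrightarrow>
     (\<exists>U. (\<forall>t\<in>{0..T}. U t \<in> L2 (lebesgue_on \<Omega>)) \<and>
          (\<forall>t\<in>{0..T}. ((\<lambda>s. L2_norm (lebesgue_on \<Omega>) (\<lambda>x. U s x - U t x)) \<longlongrightarrow> 0)
                          (at t within {0..T})) \<and>
          (AE t in lebesgue_on {0<..<T}. AE x in lebesgue_on \<Omega>. U t x = u t x) \<and>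
          (AE x in lebesgue_on \<Omega>. U 0 x = u\<^sub>0 x))"


section \<open>Clarke calculus\<close>

text \<open>
  The upper limits are finite for locally Lipschitz functions, the only ones for which the
  generalized directional derivative is considered.
\<close>

definition locally_lipschitz :: "('a::metric_space \<Rightarrow> 'b::metric_space) \<Rightarrow> bool" where
  "locally_lipschitz \<Phi> \<longleftrightarrow> (\<forall>u. \<exists>r>0. \<exists>L. L-lipschitz_on (ball u r) \<Phi>)"

definition clarke_deriv :: "('a::real_normed_vector \<Rightarrow> real) \<Rightarrow> 'a \<Rightarrow> 'a \<Rightarrow> real" where
  "clarke_deriv \<Phi> u v =
     real_of_ereal (Limsup (nhds u \<times>\<^sub>F at_right 0)
       (\<lambda>(w, h). ereal ((\<Phi> (w + h *\<^sub>R v) - \<Phi> w) / h)))"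

definition clarke_subdiff :: "('a::euclidean_space \<Rightarrow> real) \<Rightarrow> 'a \<Rightarrow> 'a set" where
  "clarke_subdiff \<Phi> u = {\<xi>. \<forall>v. clarke_deriv \<Phi> u v \<ge> \<xi> \<bullet> v}"

text \<open>The same derivative on a space \<open>X\<close> of functions with seminorm \<open>N\<close>.\<close>

definition seminorm_nhds ::
  "('a \<Rightarrow> 'b::real_vector) set \<Rightarrow> (('a \<Rightarrow> 'b) \<Rightarrow> real) \<Rightarrow> ('a \<Rightarrow> 'b) \<Rightarrow> ('a \<Rightarrow> 'b) filter" where
  "seminorm_nhds X N u = (INF r\<in>{0<..}. principal {w \<in> X. N (\<lambda>x. w x - u x) < r})"

definition clarke_deriv_on ::
  "('a \<Rightarrow> 'b::real_vector) set \<Rightarrow> (('a \<Rightarrow> 'b) \<Rightarrow> real) \<Rightarrow> (('a \<Rightarrow> 'b) \<Rightarrow> real)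
     \<Rightarrow> ('a \<Rightarrow> 'b) \<Rightarrow> ('a \<Rightarrow> 'b) \<Rightarrow> real" where
  "clarke_deriv_on X N \<Phi> u v =
     real_of_ereal (Limsup (seminorm_nhds X N u \<times>\<^sub>F at_right 0)
       (\<lambda>(w, h). ereal ((\<Phi> (\<lambda>x. w x + h *\<^sub>R v x) - \<Phi> w) / h)))"


section \<open>The superpotential and the two problems\<close>

text \<open>Measurability on \<open>\<Gamma>\<^sub>S \<times> (0,T)\<close> refers to the completed product measure.\<close>

definition space_time :: "(real^'n) set \<Rightarrow> real \<Rightarrow> ((real^'n) \<times> real) measure" where
  "space_time \<Gamma>\<^sub>S T = completion (surface_on \<Gamma>\<^sub>S \<Otimes>\<^sub>M lebesgue_on {0<..<T})"

definition superpotential ::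
  "(real^'n) set \<Rightarrow> real \<Rightarrow> (real^'n \<Rightarrow> real \<Rightarrow> real^'n \<Rightarrow> real) \<Rightarrow> bool" where
  "superpotential \<Gamma>\<^sub>S T \<psi> \<longleftrightarrow>
     (\<forall>\<xi>. (\<lambda>(x, t). \<psi> x t \<xi>) \<in> borel_measurable (space_time \<Gamma>\<^sub>S T)) \<and>
     (\<exists>\<xi>\<^sub>0 \<in> L2 (surface_on \<Gamma>\<^sub>S). AE t in lebesgue_on {0<..<T}.
        integrable (surface_on \<Gamma>\<^sub>S) (\<lambda>x. \<psi> x t (\<xi>\<^sub>0 x))) \<and>
     (AE (x, t) in space_time \<Gamma>\<^sub>S T. locally_lipschitz (\<psi> x t)) \<and>
     (\<exists>c\<^sub>0>0. AE (x, t) in space_time \<Gamma>\<^sub>S T.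
        \<forall>\<xi>. \<forall>\<eta>\<in>clarke_subdiff (\<psi> x t) \<xi>. norm \<eta> \<le> c\<^sub>0 * (1 + norm \<xi>)) \<and>
     (\<exists>\<alpha>>0. AE (x, t) in space_time \<Gamma>\<^sub>S T.
        \<forall>\<xi>\<^sub>1 \<xi>\<^sub>2. \<forall>\<eta>\<^sub>1\<in>clarke_subdiff (\<psi> x t) \<xi>\<^sub>1. \<forall>\<eta>\<^sub>2\<in>clarke_subdiff (\<psi> x t) \<xi>\<^sub>2.
          (\<eta>\<^sub>1 - \<eta>\<^sub>2) \<bullet> (\<xi>\<^sub>1 - \<xi>\<^sub>2) \<ge> - \<alpha> * (norm (\<xi>\<^sub>1 - \<xi>\<^sub>2))\<^sup>2)"

definition Psi ::
  "(real^'n) set \<Rightarrow> (real^'n \<Rightarrow> real \<Rightarrow> real^'n \<Rightarrow> real) \<Rightarrow> real \<Rightarrow> (real^'n \<Rightarrow> real^'n) \<Rightarrow> real" where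
  "Psi \<Gamma>\<^sub>S \<psi> t z = (\<integral>x. \<psi> x t (z x) \<partial>surface_on \<Gamma>\<^sub>S)"

definition Psi_deriv ::
  "(real^'n) set \<Rightarrow> (real^'n \<Rightarrow> real \<Rightarrow> real^'n \<Rightarrow> real) \<Rightarrow> real
     \<Rightarrow> (real^'n \<Rightarrow> real^'n) \<Rightarrow> (real^'n \<Rightarrow> real^'n) \<Rightarrow> real" where
  "Psi_deriv \<Gamma>\<^sub>S \<psi> t z w =
     clarke_deriv_on (L2 (surface_on \<Gamma>\<^sub>S)) (L2_norm (surface_on \<Gamma>\<^sub>S)) (Psi \<Gamma>\<^sub>S \<psi> t) z w"

definition solves_P ::
  "(real^'n) set \<Rightarrow> (real^'n) set \<Rightarrow> (real^'n) set \<Rightarrow> real \<Rightarrow> real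
     \<Rightarrow> (real^'n \<Rightarrow> real \<Rightarrow> real^'n \<Rightarrow> real)
     \<Rightarrow> (real \<Rightarrow> (real^'n \<Rightarrow> real^'n) \<Rightarrow> real) \<Rightarrow> (real^'n \<Rightarrow> real^'n)
     \<Rightarrow> (real \<Rightarrow> real^'n \<Rightarrow> real^'n) \<Rightarrow> (real \<Rightarrow> real^'n \<Rightarrow> real) \<Rightarrow> bool" where
  "solves_P \<Omega> \<Gamma>\<^sub>D \<Gamma>\<^sub>S T \<mu> \<psi> f u\<^sub>0 u p \<longleftrightarrow>
     u \<in> WW \<Omega> \<Gamma>\<^sub>D \<Gamma>\<^sub>S T \<and> p \<in> QQ \<Omega> T \<and>
     (AE t in lebesgue_on {0<..<T}.
        (\<forall>v \<in> V_space \<Omega> \<Gamma>\<^sub>D \<Gamma>\<^sub>S.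
           time_derivative \<Omega> \<Gamma>\<^sub>D \<Gamma>\<^sub>S T u t v + form_a \<Omega> \<mu> (u t) v - form_b \<Omega> v (p t)
             + (\<integral>x. clarke_deriv (\<psi> x t) (tangential_trace \<Omega> (u t) x) (tangential_trace \<Omega> v x)
                  \<partial>surface_on \<Gamma>\<^sub>S)
           \<ge> f t v) \<and>
        (\<forall>q \<in> Q_space \<Omega>. form_b \<Omega> (u t) q = 0)) \<and>
     has_initial_value \<Omega> T u u\<^sub>0"

definition solves_P' ::
  "(real^'n) set \<Rightarrow> (real^'n) set \<Rightarrow> (real^'n) set \<Rightarrow> real \<Rightarrow> real
     \<Rightarrow> (real^'n \<Rightarrow> real \<Rightarrow> real^'n \<Rightarrow> real)
     \<Rightarrow> (real \<Rightarrow> (real^'n \<Rightarrow> real^'n) \<Rightarrow> real) \<Rightarrow> (real^'n \<Rightarrow> real^'n)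
     \<Rightarrow> (real \<Rightarrow> real^'n \<Rightarrow> real^'n) \<Rightarrow> (real \<Rightarrow> real^'n \<Rightarrow> real) \<Rightarrow> bool" where
  "solves_P' \<Omega> \<Gamma>\<^sub>D \<Gamma>\<^sub>S T \<mu> \<psi> f u\<^sub>0 u p \<longleftrightarrow>
     u \<in> WW \<Omega> \<Gamma>\<^sub>D \<Gamma>\<^sub>S T \<and> p \<in> QQ \<Omega> T \<and>
     (AE t in lebesgue_on {0<..<T}.
        (\<forall>v \<in> V_space \<Omega> \<Gamma>\<^sub>D \<Gamma>\<^sub>S.
           time_derivative \<Omega> \<Gamma>\<^sub>D \<Gamma>\<^sub>S T u t v + form_a \<Omega> \<mu> (u t) v - form_b \<Omega> v (p t)
             + Psi_deriv \<Gamma>\<^sub>S \<psi> t (tangential_trace \<Omega> (u t)) (tangential_trace \<Omega> v)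
           \<ge> f t v) \<and>
        (\<forall>q \<in> Q_space \<Omega>. form_b \<Omega> (u t) q = 0)) \<and>
     has_initial_value \<Omega> T u u\<^sub>0"

text \<open>Equality of solutions as elements of the function spaces, i.e. of their classes.\<close>

definition same_solution ::
  "(real^'n) set \<Rightarrow> real
     \<Rightarrow> (real \<Rightarrow> real^'n \<Rightarrow> real^'n) \<times> (real \<Rightarrow> real^'n \<Rightarrow> real)
     \<Rightarrow> (real \<Rightarrow> real^'n \<Rightarrow> real^'n) \<times> (real \<Rightarrow> real^'n \<Rightarrow> real) \<Rightarrow> bool" where
  "same_solution \<Omega> T = (\<lambda>(u, p) (u', p').
     AE t in lebesgue_on {0<..<T}. AE x in lebesgue_on \<Omega>. u t x = u' t x \<and> p t x = p' t x)"

end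

theory Submission
  imports Defs
begin

text \<open>
  The problems differ only in the boundary term, so everything rests on the inequality
  \<open>\<Psi>\<^sup>0(t,z;w) \<le> \<integral> \<psi>\<^sup>0(x,t,z;w) ds\<close> for almost every \<open>t\<close> and all \<open>z, w \<in> L\<^sup>2\<close>. It is a reverse Fatou
  argument: along sequences realising the upper limit, chosen so that \<open>\<parallel>w\<^sub>k - z\<parallel> < 2\<^sup>-\<^sup>k\<close>, the function
  \<open>\<Sum>\<^sub>k \<bar>w\<^sub>k - z\<bar>\<^sup>2\<close> is integrable, which gives both almost everywhere convergence and a dominating
  function for the difference quotients \<open>q\<^sub>k\<close>, and dominated convergence applies to
  \<open>max q\<^sub>k \<psi>\<^sup>0\<close>. The growth bound on difference quotients comes from the one on \<open>\<partial>\<psi>\<close>: the subdifferential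
  attains the generalized derivative, by a supporting hyperplane of its epigraph. The surface
  measure must be finite on the boundary and complete, and the outward normal measurable, for the
  tangential traces to lie in \<open>L\<^sup>2\<close> and for Fubini's theorem to yield the hypotheses at fixed \<open>t\<close>.
\<close>

section \<open>Clarke derivatives of locally Lipschitz functions\<close>

lemma ereal_Limsup_eq_real:
  fixes q :: "'a \<Rightarrow> real"
  assumes "F \<noteq> bot" and "\<forall>\<^sub>F x in F. \<bar>q x\<bar> \<le> K"
  shows "ereal (real_of_ereal (Limsup F (\<lambda>x. ereal (q x)))) = Limsup F (\<lambda>x. ereal (q x))"
proof -
  have "Limsup F (\<lambda>x. ereal (q x)) \<le> ereal K"
    using assms(2) by (intro Limsup_bounded) (auto elim: eventually_mono)
  moreover have "ereal (-K) \<le> Liminf F (\<lambda>x. ereal (q x))"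
    using assms(2) by (intro Liminf_bounded) (auto elim!: eventually_mono)
  moreover have "Liminf F (\<lambda>x. ereal (q x)) \<le> Limsup F (\<lambda>x. ereal (q x))"
    using assms(1) by (rule Liminf_le_Limsup)
  ultimately show ?thesis
    by (cases "Limsup F (\<lambda>x. ereal (q x))") auto
qed

lemma real_Limsup_le:
  fixes q :: "'a \<Rightarrow> real"
  assumes "F \<noteq> bot" and "\<forall>\<^sub>F x in F. \<bar>q x\<bar> \<le> K" and "\<forall>\<^sub>F x in F. q x \<le> c"
  shows "real_of_ereal (Limsup F (\<lambda>x. ereal (q x))) \<le> c"
proof -
  have "Limsup F (\<lambda>x. ereal (q x)) \<le> ereal c"
    using assms(3) by (intro Limsup_bounded) (auto elim: eventually_mono)
  then show ?thesis
    using ereal_Limsup_eq_real[OF assms(1,2)] by (metis ereal_less_eq(3))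
qed

lemma eventually_less_real_Limsup:
  fixes q :: "'a \<Rightarrow> real"
  assumes "F \<noteq> bot" and "\<forall>\<^sub>F x in F. \<bar>q x\<bar> \<le> K"
    and "real_of_ereal (Limsup F (\<lambda>x. ereal (q x))) < c"
  shows "\<forall>\<^sub>F x in F. q x < c"
proof -
  have "Limsup F (\<lambda>x. ereal (q x)) < ereal c"
    using ereal_Limsup_eq_real[OF assms(1,2)] assms(3) by (metis ereal_less(2) less_ereal.simps(1))
  then show ?thesis
    using Limsup_lessD by fastforce
qed

lemma eventually_prod_at_right:
  assumes "\<And>Q. eventually Q F \<longleftrightarrow> (\<exists>d>0::real. \<forall>y. S y d \<longrightarrow> Q y)"
    and "\<And>y d e. S y d \<Longrightarrow> d \<le> e \<Longrightarrow> S y e"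
  shows "eventually P (F \<times>\<^sub>F at_right (0::real)) \<longleftrightarrow>
    (\<exists>d>0. \<forall>y h. S y d \<and> 0 < h \<and> h < d \<longrightarrow> P (y, h))"
proof
  assume "eventually P (F \<times>\<^sub>F at_right (0::real))"
  then obtain Pf Pg where P: "eventually Pf F" "eventually Pg (at_right 0)"
    "\<And>x y. Pf x \<Longrightarrow> Pg y \<Longrightarrow> P (x, y)"
    unfolding eventually_prod_filter by auto
  obtain d where d: "d > 0" "\<And>y. S y d \<Longrightarrow> Pf y" using P(1) assms(1) by auto
  obtain b where b: "b > 0" "\<And>h. 0 < h \<Longrightarrow> h < b \<Longrightarrow> Pg h"
    using P(2) unfolding eventually_at_right_field by auto
  show "\<exists>d>0. \<forall>y h. S y d \<and> 0 < h \<and> h < d \<longrightarrow> P (y, h)"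
    using d b P(3) assms(2)[where d="min d b" and e=d] by (intro exI[of _ "min d b"]) auto
next
  assume "\<exists>d>0. \<forall>y h. S y d \<and> 0 < h \<and> h < d \<longrightarrow> P (y, h)"
  then obtain d where d: "d > 0" "\<And>y h. S y d \<Longrightarrow> 0 < h \<Longrightarrow> h < d \<Longrightarrow> P (y, h)" by auto
  show "eventually P (F \<times>\<^sub>F at_right (0::real))"
    unfolding eventually_prod_filter using d
    by (intro exI[of _ "\<lambda>y. S y d"] exI[of _ "\<lambda>h. 0 < h \<and> h < d"])
      (auto simp: assms(1) eventually_at_right_field)
qed

lemma eventually_nhds_at_right:
  fixes u :: "'a::metric_space"
  shows "eventually P (nhds u \<times>\<^sub>F at_right (0::real)) \<longleftrightarrow>
    (\<exists>d>0. \<forall>y h. dist y u < d \<and> 0 < h \<and> h < d \<longrightarrow> P (y, h))"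
  by (rule eventually_prod_at_right) (auto simp: eventually_nhds_metric)

lemma eventually_seminorm_nhds:
  "eventually P (seminorm_nhds X N u) \<longleftrightarrow> (\<exists>d>0. \<forall>w. w \<in> X \<and> N (\<lambda>x. w x - u x) < d \<longrightarrow> P w)"
  unfolding seminorm_nhds_def
proof (subst eventually_INF_base)
  fix a b :: real assume "a \<in> {0<..}" "b \<in> {0<..}"
  then show "\<exists>x\<in>{0<..}. principal {w \<in> X. N (\<lambda>xa. w xa - u xa) < x}
      \<le> inf (principal {w \<in> X. N (\<lambda>x. w x - u x) < a}) (principal {w \<in> X. N (\<lambda>x. w x - u x) < b})"
    by (intro bexI[of _ "min a b"]) auto
qed (auto simp: eventually_principal)

lemma eventually_seminorm_nhds_at_right:
  "eventually P (seminorm_nhds X N u \<times>\<^sub>F at_right (0::real)) \<longleftrightarrow>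
    (\<exists>d>0. \<forall>w h. (w \<in> X \<and> N (\<lambda>x. w x - u x) < d) \<and> 0 < h \<and> h < d \<longrightarrow> P (w, h))"
  by (rule eventually_prod_at_right) (auto simp: eventually_seminorm_nhds)

definition difference_quotient ::
  "('a::real_vector \<Rightarrow> real) \<Rightarrow> 'a \<Rightarrow> 'a \<Rightarrow> real \<Rightarrow> real" where
  "difference_quotient \<phi> v y h = (\<phi> (y + h *\<^sub>R v) - \<phi> y) / h"

lemma locally_lipschitz_quotient_bound:
  fixes \<phi> :: "'a::real_normed_vector \<Rightarrow> real"
  assumes "locally_lipschitz \<phi>"
  obtains L where "L \<ge> 0"
    "\<And>v. \<forall>\<^sub>F (y, h) in nhds u \<times>\<^sub>F at_right 0. \<bar>difference_quotient \<phi> v y h\<bar> \<le> L * norm v"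
proof -
  obtain r L where rL: "r > 0" "L-lipschitz_on (ball u r) \<phi>"
    using assms unfolding locally_lipschitz_def by blast
  have "\<forall>\<^sub>F (y, h) in nhds u \<times>\<^sub>F at_right 0. \<bar>difference_quotient \<phi> v y h\<bar> \<le> L * norm v" for v
    unfolding eventually_nhds_at_right
  proof (intro exI[of _ "r / (2 + norm v)"] conjI allI impI)
    have nv: "2 + norm v > 0" by (simp add: add_pos_nonneg)
    then show "0 < r / (2 + norm v)" using rL(1) by simp
    fix y h assume a: "dist y u < r / (2 + norm v) \<and> 0 < h \<and> h < r / (2 + norm v)"
    have eq: "r / (2 + norm v) * (2 + norm v) = r" using nv by simp
    have "r / (2 + norm v) * 1 < r / (2 + norm v) * (2 + norm v)"
      using rL(1) nv by (intro mult_strict_left_mono) (auto simp: add_pos_nonneg)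
    then have y: "dist y u < r" using a eq by simp
    have "dist (y + h *\<^sub>R v) u \<le> dist y u + h * norm v"
      using norm_triangle_ineq[of "y - u" "h *\<^sub>R v"] a by (simp add: dist_norm algebra_simps)
    also have "\<dots> \<le> r / (2 + norm v) * 1 + r / (2 + norm v) * norm v"
      using a by (intro add_mono mult_right_mono) auto
    also have "\<dots> = r / (2 + norm v) * (1 + norm v)" by (simp only: distrib_left)
    also have "\<dots> < r / (2 + norm v) * (2 + norm v)"
      using rL(1) nv by (intro mult_strict_left_mono) auto
    also have "\<dots> = r" by (rule eq)
    finally have y': "dist (y + h *\<^sub>R v) u < r" .
    have "\<bar>\<phi> (y + h *\<^sub>R v) - \<phi> y\<bar> \<le> L * (h * norm v)"
      using lipschitz_onD[OF rL(2), of "y + h *\<^sub>R v" y] y y' a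
      by (simp add: dist_norm norm_minus_commute dist_commute)
    then show "case (y, h) of (y, h) \<Rightarrow> \<bar>difference_quotient \<phi> v y h\<bar> \<le> L * norm v"
      using a by (simp add: difference_quotient_def field_simps)
  qed
  then show ?thesis using that lipschitz_on_nonneg[OF rL(2)] by blast
qed

lemma nhds_at_right_neq_bot: "nhds (u::'a::topological_space) \<times>\<^sub>F at_right (0::real) \<noteq> bot"
  by (simp add: prod_filter_eq_bot)

lemma clarke_deriv_quotient:
  "clarke_deriv \<phi> u v = real_of_ereal (Limsup (nhds u \<times>\<^sub>F at_right 0)
     (\<lambda>z. ereal (case z of (y, h) \<Rightarrow> difference_quotient \<phi> v y h)))"
  by (simp add: clarke_deriv_def difference_quotient_def case_prod_unfold)

lemma clarke_deriv_le:
  assumes "locally_lipschitz \<phi>"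
    and "\<forall>\<^sub>F (y, h) in nhds u \<times>\<^sub>F at_right 0. difference_quotient \<phi> v y h \<le> c"
  shows "clarke_deriv \<phi> u v \<le> c"
proof -
  obtain L where "\<forall>\<^sub>F (y, h) in nhds u \<times>\<^sub>F at_right 0. \<bar>difference_quotient \<phi> v y h\<bar> \<le> L * norm v"
    using locally_lipschitz_quotient_bound[OF assms(1)] by metis
  then show ?thesis unfolding clarke_deriv_quotient using assms(2)
    by (intro real_Limsup_le[where K="L * norm v"] nhds_at_right_neq_bot)
      (auto elim!: eventually_mono simp: case_prod_unfold)
qed

lemma clarke_deriv_less:
  assumes "locally_lipschitz \<phi>" and "clarke_deriv \<phi> u v < c"
  shows "\<forall>\<^sub>F (y, h) in nhds u \<times>\<^sub>F at_right 0. difference_quotient \<phi> v y h < c"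
proof -
  obtain L where "\<forall>\<^sub>F (y, h) in nhds u \<times>\<^sub>F at_right 0. \<bar>difference_quotient \<phi> v y h\<bar> \<le> L * norm v"
    using locally_lipschitz_quotient_bound[OF assms(1)] by metis
  then have "\<forall>\<^sub>F z in nhds u \<times>\<^sub>F at_right 0. (case z of (y, h) \<Rightarrow> difference_quotient \<phi> v y h) < c"
    using assms(2) unfolding clarke_deriv_quotient
    by (intro eventually_less_real_Limsup[where K="L * norm v"] nhds_at_right_neq_bot)
      (auto elim!: eventually_mono simp: case_prod_unfold)
  then show ?thesis by (simp add: case_prod_unfold)
qed

lemma clarke_deriv_subadd:
  assumes "locally_lipschitz \<phi>"
  shows "clarke_deriv \<phi> u (v + w) \<le> clarke_deriv \<phi> u v + clarke_deriv \<phi> u w"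
proof (rule field_le_epsilon)
  fix e :: real assume "e > 0"
  let ?F = "nhds u \<times>\<^sub>F at_right (0::real)"
  have v: "\<forall>\<^sub>F (y, h) in ?F. difference_quotient \<phi> v y h < clarke_deriv \<phi> u v + e/2"
    and w: "\<forall>\<^sub>F (y, h) in ?F. difference_quotient \<phi> w y h < clarke_deriv \<phi> u w + e/2"
    using \<open>e > 0\<close> by (auto intro!: clarke_deriv_less assms)
  obtain d where d: "d > 0" "\<And>y h. dist y u < d \<Longrightarrow> 0 < h \<Longrightarrow> h < d \<Longrightarrow>
      difference_quotient \<phi> w y h < clarke_deriv \<phi> u w + e/2"
    using w unfolding eventually_nhds_at_right by auto
  have "filterlim (\<lambda>z. fst z + snd z *\<^sub>R v) (nhds (u + 0 *\<^sub>R v)) ?F"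
  proof (intro tendsto_intros)
    show "(fst \<longlongrightarrow> u) ?F" using filterlim_fst by blast
    show "(snd \<longlongrightarrow> 0) ?F" using filterlim_snd[of "at_right (0::real)" "nhds u"]
      by (rule filterlim_mono) (auto simp: at_within_le_nhds)
  qed
  then have "\<forall>\<^sub>F z in ?F. dist (fst z + snd z *\<^sub>R v) u < d"
    using d(1) by (auto dest: tendstoD)
  moreover have "\<forall>\<^sub>F z in ?F. 0 < snd z \<and> snd z < d"
    unfolding eventually_nhds_at_right using d(1) by auto
  ultimately have "\<forall>\<^sub>F (y, h) in ?F. difference_quotient \<phi> (v + w) y h
      \<le> clarke_deriv \<phi> u v + clarke_deriv \<phi> u w + e"
    using v
  proof eventually_elim
    case (elim z)
    have "difference_quotient \<phi> w (fst z + snd z *\<^sub>R v) (snd z) < clarke_deriv \<phi> u w + e/2"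
      using d(2) elim by auto
    moreover have "difference_quotient \<phi> (v + w) (fst z) (snd z) =
        difference_quotient \<phi> w (fst z + snd z *\<^sub>R v) (snd z) + difference_quotient \<phi> v (fst z) (snd z)"
      unfolding difference_quotient_def by (simp add: diff_divide_distrib algebra_simps)
    ultimately show ?case using elim by (auto simp: case_prod_unfold)
  qed
  then show "clarke_deriv \<phi> u (v + w) \<le> clarke_deriv \<phi> u v + clarke_deriv \<phi> u w + e"
    by (rule clarke_deriv_le[OF assms])
qed

lemma clarke_deriv_scale_le:
  assumes "locally_lipschitz \<phi>" and "c > 0"
  shows "clarke_deriv \<phi> u (c *\<^sub>R v) \<le> c * clarke_deriv \<phi> u v"
proof (rule field_le_epsilon)
  fix e :: real assume "e > 0"
  then have "\<forall>\<^sub>F (y, h) in nhds u \<times>\<^sub>F at_right 0.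
      difference_quotient \<phi> v y h < clarke_deriv \<phi> u v + e/c"
    using assms by (auto intro!: clarke_deriv_less)
  then obtain d where d: "d > 0" "\<And>y h. dist y u < d \<Longrightarrow> 0 < h \<Longrightarrow> h < d \<Longrightarrow>
      difference_quotient \<phi> v y h < clarke_deriv \<phi> u v + e/c"
    unfolding eventually_nhds_at_right by auto
  have "\<forall>\<^sub>F (y, h) in nhds u \<times>\<^sub>F at_right 0.
      difference_quotient \<phi> (c *\<^sub>R v) y h \<le> c * clarke_deriv \<phi> u v + e"
    unfolding eventually_nhds_at_right
  proof (intro exI[of _ "min d (d/c)"] conjI allI impI)
    show "0 < min d (d/c)" using d(1) assms(2) by simp
    fix y h assume a: "dist y u < min d (d/c) \<and> 0 < h \<and> h < min d (d/c)"
    then have "difference_quotient \<phi> v y (h * c) < clarke_deriv \<phi> u v + e/c"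
      using assms(2) by (intro d(2)) (auto simp: field_simps)
    then have "c * difference_quotient \<phi> v y (h * c) < c * (clarke_deriv \<phi> u v + e/c)"
      using assms(2) by (rule mult_strict_left_mono)
    moreover have "difference_quotient \<phi> (c *\<^sub>R v) y h = c * difference_quotient \<phi> v y (h * c)"
      using assms(2) a by (simp add: difference_quotient_def)
    ultimately show "case (y, h) of (y, h) \<Rightarrow> difference_quotient \<phi> (c *\<^sub>R v) y h \<le> c * clarke_deriv \<phi> u v + e"
      using assms(2) by (simp add: algebra_simps)
  qed
  then show "clarke_deriv \<phi> u (c *\<^sub>R v) \<le> c * clarke_deriv \<phi> u v + e"
    by (rule clarke_deriv_le[OF assms(1)])
qed

lemma clarke_deriv_scale:
  assumes "locally_lipschitz \<phi>" and "c > 0"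
  shows "clarke_deriv \<phi> u (c *\<^sub>R v) = c * clarke_deriv \<phi> u v"
proof (rule antisym)
  show "clarke_deriv \<phi> u (c *\<^sub>R v) \<le> c * clarke_deriv \<phi> u v"
    using assms by (rule clarke_deriv_scale_le)
  have "clarke_deriv \<phi> u ((1/c) *\<^sub>R c *\<^sub>R v) \<le> (1/c) * clarke_deriv \<phi> u (c *\<^sub>R v)"
    using assms by (intro clarke_deriv_scale_le) auto
  then show "c * clarke_deriv \<phi> u v \<le> clarke_deriv \<phi> u (c *\<^sub>R v)"
    using assms(2) by (simp add: field_simps)
qed

lemma locally_lipschitz_continuous:
  fixes \<phi> :: "'a::metric_space \<Rightarrow> 'b::metric_space"
  assumes "locally_lipschitz \<phi>"
  shows "continuous_on A \<phi>"
proof -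
  have "isCont \<phi> u" for u
  proof -
    obtain r L where "r > 0" "L-lipschitz_on (ball u r) \<phi>"
      using assms unfolding locally_lipschitz_def by blast
    then show ?thesis
      by (auto dest!: lipschitz_on_continuous_on simp: continuous_on_eq_continuous_at)
  qed
  then show ?thesis by (simp add: continuous_at_imp_continuous_on)
qed

lemma clarke_deriv_zero:
  assumes "locally_lipschitz \<phi>"
  shows "clarke_deriv \<phi> u 0 = 0"
  using clarke_deriv_scale[OF assms, of 2 u 0] by simp

lemma convex_clarke_strict_epigraph:
  assumes "locally_lipschitz \<phi>"
  shows "convex {(v, s). clarke_deriv \<phi> u (v + v\<^sub>0) - c < s}"
proof (rule convexI)
  let ?p = "clarke_deriv \<phi> u"
  fix X Y :: "'a \<times> real" and a b :: real
  assume X: "X \<in> {(v, s). ?p (v + v\<^sub>0) - c < s}" and Y: "Y \<in> {(v, s). ?p (v + v\<^sub>0) - c < s}"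
    and ab: "0 \<le> a" "0 \<le> b" "a + b = 1"
  obtain v s w t where XY: "X = (v, s)" "Y = (w, t)" by (cases X, cases Y)
  have scale: "?p (r *\<^sub>R x) = r * ?p x" if "r \<ge> 0" for r x
    using clarke_deriv_scale[OF assms, of r] clarke_deriv_zero[OF assms] that
    by (cases "r = 0") auto
  have eq: "(a *\<^sub>R v + b *\<^sub>R w) + v\<^sub>0 = a *\<^sub>R (v + v\<^sub>0) + b *\<^sub>R (w + v\<^sub>0)"
    using ab(3) scaleR_left_distrib[of a b v\<^sub>0] by (simp add: algebra_simps)
  have "?p ((a *\<^sub>R v + b *\<^sub>R w) + v\<^sub>0) \<le> a * ?p (v + v\<^sub>0) + b * ?p (w + v\<^sub>0)"
    unfolding eq using clarke_deriv_subadd[OF assms] scale ab by metis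
  moreover have "a * ?p (v + v\<^sub>0) + b * ?p (w + v\<^sub>0) < a * (s + c) + b * (t + c)"
  proof (cases "a = 0")
    case True then show ?thesis using X Y XY ab by auto
  next
    case False
    then have "a * ?p (v + v\<^sub>0) < a * (s + c)" using X XY ab by auto
    moreover have "b * ?p (w + v\<^sub>0) \<le> b * (t + c)" using Y XY ab by (intro mult_left_mono) auto
    ultimately show ?thesis by simp
  qed
  moreover have "a * (s + c) + b * (t + c) = a * s + b * t + c"
    using ab(3) distrib_right[of a b c] by (simp add: algebra_simps)
  ultimately show "a *\<^sub>R X + b *\<^sub>R Y \<in> {(v, s). ?p (v + v\<^sub>0) - c < s}"
    by (auto simp: XY)
qed

lemma clarke_subdiff_attains:
  fixes \<phi> :: "'a::euclidean_space \<Rightarrow> real"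
  assumes "locally_lipschitz \<phi>"
  obtains \<eta> where "\<eta> \<in> clarke_subdiff \<phi> u" "\<eta> \<bullet> v\<^sub>0 = clarke_deriv \<phi> u v\<^sub>0"
proof -
  let ?p = "clarke_deriv \<phi> u"
  define S where "S = {(v, s). ?p (v + v\<^sub>0) - ?p v\<^sub>0 < s}"
  have "convex S" unfolding S_def by (rule convex_clarke_strict_epigraph[OF assms])
  moreover have "0 \<notin> S" by (simp add: S_def zero_prod_def)
  ultimately obtain z where "z \<noteq> 0" "\<forall>x\<in>S. 0 \<le> z \<bullet> x"
    using separating_hyperplane_set_0 by blast
  moreover obtain a b where "z = (a, b)" by (cases z)
  ultimately have z: "(a, b) \<noteq> 0" "\<And>v s. (v, s) \<in> S \<Longrightarrow> 0 \<le> a \<bullet> v + b * s"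
    by fastforce+
  have pos: "0 \<le> a \<bullet> v + b * (?p (v + v\<^sub>0) - ?p v\<^sub>0 + s)" if "s > 0" for v s
    using that by (intro z(2)) (simp add: S_def)
  have b: "b > 0"
  proof (rule ccontr)
    assume "\<not> b > 0"
    moreover have "b \<ge> 0" using pos[of 1 0] by simp
    ultimately have "b = 0" by simp
    then have "0 \<le> a \<bullet> (-a)" using pos[of 1 "-a"] by simp
    then have "a = 0" using inner_ge_zero[of a] by (simp add: order_antisym)
    then show False using z(1) \<open>b = 0\<close> by (simp add: zero_prod_def)
  qed
  define \<eta> where "\<eta> = (- 1 / b) *\<^sub>R a"
  have sub: "\<eta> \<bullet> v \<le> ?p (v + v\<^sub>0) - ?p v\<^sub>0" for v
  proof (rule field_le_epsilon)
    fix s :: real assume "s > 0"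
    then show "\<eta> \<bullet> v \<le> ?p (v + v\<^sub>0) - ?p v\<^sub>0 + s"
      using pos[of s v] b by (simp add: \<eta>_def field_simps)
  qed
  have "\<eta> \<bullet> v\<^sub>0 \<le> ?p v\<^sub>0"
    using sub[of v\<^sub>0] clarke_deriv_scale[OF assms, of 2 u v\<^sub>0] by (simp add: scaleR_2)
  moreover have "?p v\<^sub>0 \<le> \<eta> \<bullet> v\<^sub>0"
    using sub[of "- v\<^sub>0"] by (simp add: clarke_deriv_zero[OF assms])
  ultimately have "\<eta> \<bullet> v\<^sub>0 = ?p v\<^sub>0" by (rule antisym)
  moreover have "\<eta> \<bullet> v \<le> ?p v" for v
    using sub[of v] clarke_deriv_subadd[OF assms, of u v v\<^sub>0] by simp
  ultimately show ?thesis
    by (intro that[of \<eta>]) (auto simp: clarke_subdiff_def)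
qed

lemma clarke_deriv_growth:
  fixes \<phi> :: "'a::euclidean_space \<Rightarrow> real"
  assumes "locally_lipschitz \<phi>"
    and "\<forall>\<xi>. \<forall>\<eta>\<in>clarke_subdiff \<phi> \<xi>. norm \<eta> \<le> c * (1 + norm \<xi>)"
  shows "\<bar>clarke_deriv \<phi> u v\<bar> \<le> c * (1 + norm u) * norm v"
proof -
  have *: "clarke_deriv \<phi> u w \<le> c * (1 + norm u) * norm w" for w
  proof -
    obtain \<eta> where \<eta>: "\<eta> \<in> clarke_subdiff \<phi> u" "\<eta> \<bullet> w = clarke_deriv \<phi> u w"
      using clarke_subdiff_attains[OF assms(1)] .
    have "clarke_deriv \<phi> u w \<le> norm \<eta> * norm w"
      using \<eta>(2) norm_cauchy_schwarz[of \<eta> w] by simp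
    also have "\<dots> \<le> c * (1 + norm u) * norm w"
      using assms(2) \<eta>(1) by (intro mult_right_mono) auto
    finally show ?thesis .
  qed
  have "0 \<le> clarke_deriv \<phi> u v + clarke_deriv \<phi> u (- v)"
    using clarke_deriv_subadd[OF assms(1), of u v "- v"] by (simp add: clarke_deriv_zero[OF assms(1)])
  then show ?thesis using *[of v] *[of "- v"] by simp
qed

lemma clarke_mean_value_le:
  fixes \<phi> :: "'a::real_normed_vector \<Rightarrow> real"
  assumes "locally_lipschitz \<phi>"
    and "\<And>s. 0 \<le> s \<Longrightarrow> s \<le> 1 \<Longrightarrow> clarke_deriv \<phi> (a + s *\<^sub>R v) v \<le> K"
  shows "\<phi> (a + v) - \<phi> a \<le> K"
proof (rule field_le_epsilon)
  fix e :: real assume "e > 0"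
  have "\<phi> (a + 1 *\<^sub>R v) - \<phi> (a + 0 *\<^sub>R v) \<le> (K + e) * (1 - 0)"
  proof (rule Bolzano[of 0 1 "\<lambda>s t. \<phi> (a + t *\<^sub>R v) - \<phi> (a + s *\<^sub>R v) \<le> (K + e) * (t - s)"])
    fix x :: real assume x: "0 \<le> x" "x \<le> 1"
    have "clarke_deriv \<phi> (a + x *\<^sub>R v) v < K + e"
      using assms(2)[OF x] \<open>e > 0\<close> by simp
    from clarke_deriv_less[OF assms(1) this] obtain d where d: "d > 0"
      "\<And>y h. dist y (a + x *\<^sub>R v) < d \<Longrightarrow> 0 < h \<Longrightarrow> h < d \<Longrightarrow> difference_quotient \<phi> v y h < K + e"
      unfolding eventually_nhds_at_right by auto
    show "\<exists>d>0. \<forall>s t. s \<le> x \<and> x \<le> t \<and> t - s < d \<longrightarrow>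
        \<phi> (a + t *\<^sub>R v) - \<phi> (a + s *\<^sub>R v) \<le> (K + e) * (t - s)"
    proof (intro exI[of _ "min d (d / (1 + norm v))"] conjI allI impI)
      have nv: "1 + norm v > 0" by (simp add: add_pos_nonneg)
      then show "0 < min d (d / (1 + norm v))" using d(1) by simp
      fix s t assume st: "s \<le> x \<and> x \<le> t \<and> t - s < min d (d / (1 + norm v))"
      show "\<phi> (a + t *\<^sub>R v) - \<phi> (a + s *\<^sub>R v) \<le> (K + e) * (t - s)"
      proof (cases "s = t")
        case False
        have "dist (a + s *\<^sub>R v) (a + x *\<^sub>R v) = (x - s) * norm v"
          using st by (simp add: dist_norm flip: scaleR_left_diff_distrib)
        also have "\<dots> \<le> (t - s) * (1 + norm v)"
          using st by (intro mult_mono) auto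
        also have "\<dots> < d" using st nv by (simp add: field_simps)
        finally have "difference_quotient \<phi> v (a + s *\<^sub>R v) (t - s) < K + e"
          using st False by (intro d(2)) auto
        then show ?thesis using False st
          by (simp add: difference_quotient_def field_simps)
      qed simp
    qed
  next
    fix r s t :: real
    assume "\<phi> (a + s *\<^sub>R v) - \<phi> (a + r *\<^sub>R v) \<le> (K + e) * (s - r)"
      "\<phi> (a + t *\<^sub>R v) - \<phi> (a + s *\<^sub>R v) \<le> (K + e) * (t - s)"
    then show "\<phi> (a + t *\<^sub>R v) - \<phi> (a + r *\<^sub>R v) \<le> (K + e) * (t - r)"
      by (simp add: algebra_simps)
  qed simp
  then show "\<phi> (a + v) - \<phi> a \<le> K + e" by simp
qed

lemma clarke_growth_lipschitz:
  fixes \<phi> :: "'a::euclidean_space \<Rightarrow> real"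
  assumes "locally_lipschitz \<phi>" and "c \<ge> 0"
    and "\<forall>\<xi>. \<forall>\<eta>\<in>clarke_subdiff \<phi> \<xi>. norm \<eta> \<le> c * (1 + norm \<xi>)"
  shows "\<bar>\<phi> b - \<phi> a\<bar> \<le> c * (1 + norm a + norm b) * norm (b - a)"
proof -
  have *: "\<phi> b - \<phi> a \<le> c * (1 + norm a + norm b) * norm (b - a)" for a b
  proof -
    have "\<phi> (a + (b - a)) - \<phi> a \<le> c * (1 + norm a + norm b) * norm (b - a)"
    proof (rule clarke_mean_value_le[OF assms(1)])
      fix s :: real assume s: "0 \<le> s" "s \<le> 1"
      have "a + s *\<^sub>R (b - a) = (1 - s) *\<^sub>R a + s *\<^sub>R b" by (simp add: algebra_simps)
      then have "norm (a + s *\<^sub>R (b - a)) \<le> (1 - s) * norm a + s * norm b"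
        using norm_triangle_ineq[of "(1 - s) *\<^sub>R a" "s *\<^sub>R b"] s by simp
      also have "\<dots> \<le> 1 * norm a + 1 * norm b" using s by (intro add_mono mult_right_mono) auto
      finally have "c * (1 + norm (a + s *\<^sub>R (b - a))) * norm (b - a)
          \<le> c * (1 + norm a + norm b) * norm (b - a)"
        using assms(2) by (intro mult_right_mono mult_left_mono) auto
      then show "clarke_deriv \<phi> (a + s *\<^sub>R (b - a)) (b - a) \<le> c * (1 + norm a + norm b) * norm (b - a)"
        using clarke_deriv_growth[OF assms(1,3), of "a + s *\<^sub>R (b - a)" "b - a"] by simp
    qed
    then show ?thesis by simp
  qed
  show ?thesis using *[of b a] *[of a b] by (simp add: norm_minus_commute abs_le_iff algebra_simps)
qed

lemma clarke_deriv_less_iff_dense: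
  fixes \<phi> :: "'a::euclidean_space \<Rightarrow> real"
  assumes "locally_lipschitz \<phi>"
    and "\<And>U. open U \<Longrightarrow> U \<noteq> {} \<Longrightarrow> \<exists>d\<in>D. d \<in> U"
  shows "clarke_deriv \<phi> u v < c \<longleftrightarrow>
    (\<exists>k n. \<forall>d\<in>D. norm (fst d) < 1 / real (Suc n) \<and> 0 < snd d \<and> snd d < 1 / real (Suc n) \<longrightarrow>
       difference_quotient \<phi> v (u + fst d) (snd d) \<le> c - 1 / real (Suc k))" (is "_ \<longleftrightarrow> ?R")
proof
  assume "clarke_deriv \<phi> u v < c"
  then obtain k where k: "1 / real (Suc k) < c - clarke_deriv \<phi> u v"
    using nat_approx_posE[of "c - clarke_deriv \<phi> u v"] by auto
  then have "clarke_deriv \<phi> u v < c - 1 / real (Suc k)" by simp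
  from clarke_deriv_less[OF assms(1) this] obtain e where e: "e > 0"
    "\<And>y h. dist y u < e \<Longrightarrow> 0 < h \<Longrightarrow> h < e \<Longrightarrow> difference_quotient \<phi> v y h < c - 1 / real (Suc k)"
    unfolding eventually_nhds_at_right by auto
  obtain n where n: "1 / real (Suc n) < e" using nat_approx_posE[OF e(1)] by auto
  show ?R
    by (intro exI[of _ k] exI[of _ n] ballI impI less_imp_le e(2)) (use n in \<open>auto simp: dist_norm\<close>)
next
  assume ?R
  then obtain k n where kn: "\<And>d. d \<in> D \<Longrightarrow> norm (fst d) < 1 / real (Suc n) \<Longrightarrow> 0 < snd d \<Longrightarrow>
      snd d < 1 / real (Suc n) \<Longrightarrow> difference_quotient \<phi> v (u + fst d) (snd d) \<le> c - 1 / real (Suc k)"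
    by blast
  define U where "U = {d :: 'a \<times> real. norm (fst d) < 1 / real (Suc n) \<and> 0 < snd d \<and> snd d < 1 / real (Suc n)}"
  have "open U"
    unfolding U_def by (intro open_Collect_conj open_Collect_less continuous_intros)
  have "continuous_on U (\<lambda>d. difference_quotient \<phi> v (u + fst d) (snd d))"
    unfolding difference_quotient_def U_def
    by (intro continuous_intros continuous_on_compose2[OF locally_lipschitz_continuous[OF assms(1), of UNIV]])
      auto
  then have "open (U \<inter> (\<lambda>d. difference_quotient \<phi> v (u + fst d) (snd d)) -` {c - 1 / real (Suc k)<..})"
    using \<open>open U\<close> by (simp add: continuous_on_open_vimage Int_commute)
  then have "U \<inter> (\<lambda>d. difference_quotient \<phi> v (u + fst d) (snd d)) -` {c - 1 / real (Suc k)<..} = {}"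
    using assms(2) kn unfolding U_def by (smt (verit) IntD1 IntD2 greaterThan_iff mem_Collect_eq vimageD)
  then have all: "difference_quotient \<phi> v (u + fst d) (snd d) \<le> c - 1 / real (Suc k)" if "d \<in> U" for d
    using that by fastforce
  have "\<forall>\<^sub>F (y, h) in nhds u \<times>\<^sub>F at_right 0. difference_quotient \<phi> v y h \<le> c - 1 / real (Suc k)"
    unfolding eventually_nhds_at_right
  proof (intro exI[of _ "1 / real (Suc n)"] conjI allI impI)
    fix y h assume "dist y u < 1 / real (Suc n) \<and> 0 < h \<and> h < 1 / real (Suc n)"
    then show "case (y, h) of (y, h) \<Rightarrow> difference_quotient \<phi> v y h \<le> c - 1 / real (Suc k)"
      using all[of "(y - u, h)"] by (simp add: U_def dist_norm)
  qed simp
  then have "clarke_deriv \<phi> u v \<le> c - 1 / real (Suc k)" by (rule clarke_deriv_le[OF assms(1)])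
  then show "clarke_deriv \<phi> u v < c"
    by (smt (verit) divide_pos_pos of_nat_0_less_iff zero_less_Suc)
qed

lemma caratheodory_measurable:
  fixes \<phi> :: "'a \<Rightarrow> 'b::euclidean_space \<Rightarrow> real"
  assumes cont: "\<And>x. continuous_on UNIV (\<phi> x)"
    and meas: "\<And>\<xi>. (\<lambda>x. \<phi> x \<xi>) \<in> borel_measurable M"
    and z: "z \<in> borel_measurable M"
  shows "(\<lambda>x. \<phi> x (z x)) \<in> borel_measurable M"
proof -
  obtain F where F: "\<And>i. simple_function M (F i)" "\<And>x. x \<in> space M \<Longrightarrow> (\<lambda>i. F i x) \<longlonglongrightarrow> z x"
    using borel_measurable_implies_sequence_metric[OF z, of undefined] by blast
  have "(\<lambda>x. \<phi> x (F i x)) \<in> borel_measurable M" for i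
  proof (rule measurable_compose_countable'[where I = "F i ` space M"])
    show "F i \<in> measurable M (count_space (F i ` space M))"
      using F(1)[of i] by (subst measurable_count_space_eq2) (auto simp: simple_function_def)
    show "countable (F i ` space M)"
      using F(1)[of i] by (simp add: simple_function_def countable_finite)
  qed (rule meas)
  then show ?thesis
  proof (rule borel_measurable_LIMSEQ_metric)
    fix x assume "x \<in> space M"
    then show "(\<lambda>i. \<phi> x (F i x)) \<longlonglongrightarrow> \<phi> x (z x)"
      using F(2) cont by (intro isCont_tendsto_compose[of _ "\<phi> x"])
        (auto simp: continuous_on_eq_continuous_at)
  qed
qed

lemma clarke_deriv_measurable:
  fixes \<phi> :: "'a \<Rightarrow> 'b::euclidean_space \<Rightarrow> real"
  assumes lip: "\<And>x. locally_lipschitz (\<phi> x)"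
    and meas: "\<And>\<xi>. (\<lambda>x. \<phi> x \<xi>) \<in> borel_measurable M"
    and [measurable]: "z \<in> borel_measurable M" "w \<in> borel_measurable M"
  shows "(\<lambda>x. clarke_deriv (\<phi> x) (z x) (w x)) \<in> borel_measurable M"
proof -
  obtain D :: "('b \<times> real) set" where D: "countable D"
    "\<And>U. open U \<Longrightarrow> U \<noteq> {} \<Longrightarrow> \<exists>d\<in>D. d \<in> U" using countable_dense_setE by blast
  note comp = caratheodory_measurable[OF locally_lipschitz_continuous[OF lip] meas]
  have q: "(\<lambda>x. difference_quotient (\<phi> x) (w x) (z x + y) h) \<in> borel_measurable M" for y h
    unfolding difference_quotient_def
    by (intro borel_measurable_divide borel_measurable_diff comp) measurable
  show ?thesis
  proof (subst borel_measurable_iff_less, rule allI)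
    fix c
    have "{x \<in> space M. clarke_deriv (\<phi> x) (z x) (w x) < c} =
      (\<Union>k. \<Union>n. {x \<in> space M. \<forall>d\<in>D. norm (fst d) < 1 / real (Suc n) \<and> 0 < snd d \<and> snd d < 1 / real (Suc n) \<longrightarrow>
        difference_quotient (\<phi> x) (w x) (z x + fst d) (snd d) \<le> c - 1 / real (Suc k)})"
      using clarke_deriv_less_iff_dense[OF lip D(2)] by auto
    also have "\<dots> \<in> sets M"
    proof (intro sets.countable_UN'' countableI_type sets.sets_Collect_countable_All'[OF _ D(1)])
      fix k n :: nat and d :: "'b \<times> real"
      have "{x \<in> space M. difference_quotient (\<phi> x) (w x) (z x + fst d) (snd d) \<le> c - 1 / real (Suc k)} \<in> sets M"
        using q[of "fst d" "snd d"] by measurable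
      then show "{x \<in> space M. norm (fst d) < 1 / real (Suc n) \<and> 0 < snd d \<and> snd d < 1 / real (Suc n) \<longrightarrow>
        difference_quotient (\<phi> x) (w x) (z x + fst d) (snd d) \<le> c - 1 / real (Suc k)} \<in> sets M"
        by (intro sets.sets_Collect_imp sets.sets_Collect_const)
    qed
    finally show "{x \<in> space M. clarke_deriv (\<phi> x) (z x) (w x) < c} \<in> sets M" .
  qed
qed

section \<open>Integral functionals on square-integrable functions\<close>

lemma L2_add:
  assumes "f \<in> L2 M" "g \<in> L2 M"
  shows "(\<lambda>x. f x + g x) \<in> L2 M"
proof -
  have [measurable]: "f \<in> borel_measurable M" "g \<in> borel_measurable M" using assms by (auto simp: L2_def)
  have "integrable M (\<lambda>x. (norm (f x + g x))\<^sup>2)"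
  proof (rule Bochner_Integration.integrable_bound)
    show "integrable M (\<lambda>x. 2 * (norm (f x))\<^sup>2 + 2 * (norm (g x))\<^sup>2)"
      using assms by (auto simp: L2_def)
    have "(norm (f x + g x))\<^sup>2 \<le> 2 * (norm (f x))\<^sup>2 + 2 * (norm (g x))\<^sup>2" for x
    proof -
      have "(norm (f x + g x))\<^sup>2 \<le> (norm (f x) + norm (g x))\<^sup>2"
        by (intro power_mono norm_triangle_ineq norm_ge_zero)
      also have "\<dots> \<le> 2 * (norm (f x))\<^sup>2 + 2 * (norm (g x))\<^sup>2"
        using zero_le_power2[of "norm (f x) - norm (g x)"] by (simp add: power2_sum power2_diff)
      finally show ?thesis .
    qed
    then show "AE x in M. norm ((norm (f x + g x))\<^sup>2) \<le> norm (2 * (norm (f x))\<^sup>2 + 2 * (norm (g x))\<^sup>2)"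
      by (intro AE_I2) simp
  qed measurable
  then show ?thesis by (simp add: L2_def)
qed

lemma L2_scaleR:
  assumes "f \<in> L2 M"
  shows "(\<lambda>x. c *\<^sub>R f x) \<in> L2 M"
  using assms by (auto simp: L2_def power_mult_distrib)

lemma L2_diff:
  assumes "f \<in> L2 M" "g \<in> L2 M"
  shows "(\<lambda>x. f x - g x) \<in> L2 M"
  using L2_add[OF assms(1) L2_scaleR[OF assms(2), of "-1"]] by simp

lemma L2_norm_nonneg: "0 \<le> L2_norm M f"
  by (simp add: L2_norm_def)

lemma L2_norm_power2: "(L2_norm M f)\<^sup>2 = (\<integral>x. (norm (f x))\<^sup>2 \<partial>M)"
  by (simp add: L2_norm_def)

lemma (in finite_measure) L2_integrable_norm:
  assumes "f \<in> L2 M"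
  shows "integrable M (\<lambda>x. norm (f x))"
proof (rule Bochner_Integration.integrable_bound)
  show "integrable M (\<lambda>x. 1 + (norm (f x))\<^sup>2)" using assms by (auto simp: L2_def)
  show "(\<lambda>x. norm (f x)) \<in> borel_measurable M" using assms by (auto simp: L2_def)
  have "t \<le> 1 + t\<^sup>2" for t :: real
  proof -
    have "2 * t \<le> t\<^sup>2 + 1" using zero_le_power2[of "t - 1"] by (simp add: power2_diff)
    then show ?thesis using zero_le_power2[of t] by linarith
  qed
  then show "AE x in M. norm (norm (f x)) \<le> norm (1 + (norm (f x))\<^sup>2)" by simp
qed

lemma summable_L2_AE:
  fixes f :: "nat \<Rightarrow> 'a \<Rightarrow> 'b::euclidean_space"
  assumes L2: "\<And>k. f k \<in> L2 M" and sum: "summable (\<lambda>k. (L2_norm M (f k))\<^sup>2)"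
  shows "AE x in M. summable (\<lambda>k. (norm (f k x))\<^sup>2)"
    and "integrable M (\<lambda>x. \<Sum>k. (norm (f k x))\<^sup>2)"
proof -
  have [measurable]: "f k \<in> borel_measurable M" for k using L2 by (auto simp: L2_def)
  have int: "integrable M (\<lambda>x. (norm (f k x))\<^sup>2)" for k using L2 by (auto simp: L2_def)
  have "(\<integral>\<^sup>+x. (\<Sum>k. ennreal ((norm (f k x))\<^sup>2)) \<partial>M) = (\<Sum>k. \<integral>\<^sup>+x. ennreal ((norm (f k x))\<^sup>2) \<partial>M)"
    by (rule nn_integral_suminf) measurable
  also have "\<dots> = (\<Sum>k. ennreal ((L2_norm M (f k))\<^sup>2))"
    by (simp add: nn_integral_eq_integral int L2_norm_power2)
  also have "\<dots> = ennreal (\<Sum>k. (L2_norm M (f k))\<^sup>2)"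
    by (intro suminf_ennreal2 sum) simp
  finally have "AE x in M. (\<Sum>k. ennreal ((norm (f k x))\<^sup>2)) \<noteq> \<infinity>"
    by (intro nn_integral_noteq_infinite) auto
  then show ae: "AE x in M. summable (\<lambda>k. (norm (f k x))\<^sup>2)"
    by (auto elim!: eventually_mono intro!: summable_suminf_not_top)
  show "integrable M (\<lambda>x. \<Sum>k. (norm (f k x))\<^sup>2)"
    using int ae sum by (intro integrable_suminf) (auto simp: L2_norm_power2)
qed

locale superpotential_integrand = finite_measure M
  for M :: "'a measure" +
  fixes \<phi> :: "'a \<Rightarrow> 'b::euclidean_space \<Rightarrow> real" and c :: real
  assumes measurable_phi: "\<And>\<xi>. (\<lambda>x. \<phi> x \<xi>) \<in> borel_measurable M"
    and integrable_base: "\<exists>\<xi>\<^sub>0\<in>L2 M. integrable M (\<lambda>x. \<phi> x (\<xi>\<^sub>0 x))"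
    and locally_lipschitz_phi: "\<And>x. locally_lipschitz (\<phi> x)"
    and c_nonneg: "0 \<le> c"
    and growth: "\<And>x. \<forall>\<xi>. \<forall>\<eta>\<in>clarke_subdiff (\<phi> x) \<xi>. norm \<eta> \<le> c * (1 + norm \<xi>)"
begin

lemma comp_measurable [measurable]:
  "z \<in> borel_measurable M \<Longrightarrow> (\<lambda>x. \<phi> x (z x)) \<in> borel_measurable M"
  by (rule caratheodory_measurable[OF locally_lipschitz_continuous[OF locally_lipschitz_phi] measurable_phi])

lemma difference_bound:
  "\<bar>\<phi> x b - \<phi> x a\<bar> \<le> c * (norm (b - a) + (norm a)\<^sup>2 + 3 * (norm (b - a))\<^sup>2)"
proof -
  have "norm b \<le> norm a + norm (b - a)" using norm_triangle_ineq[of a "b - a"] by simp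
  then have "(1 + norm a + norm b) * norm (b - a) \<le> (1 + 2 * norm a + norm (b - a)) * norm (b - a)"
    by (intro mult_right_mono) auto
  also have "\<dots> = norm (b - a) + 2 * norm a * norm (b - a) + (norm (b - a))\<^sup>2"
    by (simp add: algebra_simps power2_eq_square)
  also have "\<dots> \<le> norm (b - a) + (norm a)\<^sup>2 + 3 * (norm (b - a))\<^sup>2"
    using zero_le_power2[of "norm a - norm (b - a)"] zero_le_power2[of "norm (b - a)"]
    unfolding power2_diff by linarith
  finally have "c * ((1 + norm a + norm b) * norm (b - a)) \<le> c * (norm (b - a) + (norm a)\<^sup>2 + 3 * (norm (b - a))\<^sup>2)"
    using c_nonneg by (rule mult_left_mono)
  then show ?thesis
    using clarke_growth_lipschitz[OF locally_lipschitz_phi c_nonneg growth, of x b a]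
    by (simp add: mult.assoc)
qed

lemma quotient_bound:
  assumes "0 < h" "h \<le> 1"
  shows "\<bar>difference_quotient (\<phi> x) v y h\<bar>
     \<le> c * (norm v + 2 * (norm u)\<^sup>2 + 2 * (norm (y - u))\<^sup>2 + 2 * (norm v)\<^sup>2)"
proof -
  have "\<bar>\<phi> x (y + h *\<^sub>R v) - \<phi> x y\<bar> \<le> c * (1 + norm y + norm (y + h *\<^sub>R v)) * (h * norm v)"
    using clarke_growth_lipschitz[OF locally_lipschitz_phi c_nonneg growth, of x "y + h *\<^sub>R v" y] assms
    by simp
  then have "\<bar>difference_quotient (\<phi> x) v y h\<bar> \<le> c * ((1 + norm y + norm (y + h *\<^sub>R v)) * norm v)"
    using assms by (simp add: difference_quotient_def field_simps)
  also have "\<dots> \<le> c * (norm v + 2 * (norm u)\<^sup>2 + 2 * (norm (y - u))\<^sup>2 + 2 * (norm v)\<^sup>2)"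
  proof (rule mult_left_mono[OF _ c_nonneg])
    have "norm (y + h *\<^sub>R v) \<le> norm y + norm (h *\<^sub>R v)" by (rule norm_triangle_ineq)
    also have "norm (h *\<^sub>R v) \<le> norm v" using assms by (simp add: mult_left_le_one_le)
    finally have "(1 + norm y + norm (y + h *\<^sub>R v)) * norm v \<le> (1 + 2 * norm y + norm v) * norm v"
      by (intro mult_right_mono) auto
    also have "\<dots> = norm v + 2 * norm y * norm v + (norm v)\<^sup>2"
      by (simp add: algebra_simps power2_eq_square)
    also have "\<dots> \<le> norm v + (norm y)\<^sup>2 + 2 * (norm v)\<^sup>2"
      using zero_le_power2[of "norm y - norm v"] unfolding power2_diff by linarith
    also have "(norm y)\<^sup>2 \<le> (norm u + norm (y - u))\<^sup>2"
      using norm_triangle_ineq[of u "y - u"] by (intro power_mono) auto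
    also have "(norm u + norm (y - u))\<^sup>2 \<le> 2 * (norm u)\<^sup>2 + 2 * (norm (y - u))\<^sup>2"
      using zero_le_power2[of "norm u - norm (y - u)"] unfolding power2_diff power2_sum by linarith
    finally show "(1 + norm y + norm (y + h *\<^sub>R v)) * norm v
        \<le> norm v + 2 * (norm u)\<^sup>2 + 2 * (norm (y - u))\<^sup>2 + 2 * (norm v)\<^sup>2" by simp
  qed
  finally show ?thesis .
qed

lemma comp_integrable:
  assumes "z \<in> L2 M"
  shows "integrable M (\<lambda>x. \<phi> x (z x))"
proof -
  obtain \<xi>\<^sub>0 where xi: "\<xi>\<^sub>0 \<in> L2 M" "integrable M (\<lambda>x. \<phi> x (\<xi>\<^sub>0 x))" using integrable_base by blast
  have d: "(\<lambda>x. z x - \<xi>\<^sub>0 x) \<in> L2 M" by (intro L2_diff assms xi)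
  have [measurable]: "z \<in> borel_measurable M" "\<xi>\<^sub>0 \<in> borel_measurable M"
    using assms xi by (auto simp: L2_def)
  have "integrable M (\<lambda>x. \<phi> x (z x) - \<phi> x (\<xi>\<^sub>0 x))"
  proof (rule Bochner_Integration.integrable_bound)
    show "integrable M (\<lambda>x. c * (norm (z x - \<xi>\<^sub>0 x) + (norm (\<xi>\<^sub>0 x))\<^sup>2 + 3 * (norm (z x - \<xi>\<^sub>0 x))\<^sup>2))"
      using xi(1) d L2_integrable_norm[OF d] by (auto simp: L2_def)
    show "AE x in M. norm (\<phi> x (z x) - \<phi> x (\<xi>\<^sub>0 x))
        \<le> norm (c * (norm (z x - \<xi>\<^sub>0 x) + (norm (\<xi>\<^sub>0 x))\<^sup>2 + 3 * (norm (z x - \<xi>\<^sub>0 x))\<^sup>2))"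
      using c_nonneg difference_bound by (intro AE_I2) (simp add: order_trans[OF _ abs_ge_self])
  qed measurable
  from Bochner_Integration.integrable_add[OF this xi(2)] show ?thesis by simp
qed

lemma clarke_integrable:
  assumes "z \<in> L2 M" "v \<in> L2 M"
  shows "integrable M (\<lambda>x. clarke_deriv (\<phi> x) (z x) (v x))"
proof (rule Bochner_Integration.integrable_bound)
  show "integrable M (\<lambda>x. c * (norm (v x) + (norm (z x))\<^sup>2 + (norm (v x))\<^sup>2))"
    using assms L2_integrable_norm[OF assms(2)] by (auto simp: L2_def)
  show "(\<lambda>x. clarke_deriv (\<phi> x) (z x) (v x)) \<in> borel_measurable M"
    using assms by (intro clarke_deriv_measurable locally_lipschitz_phi measurable_phi) (auto simp: L2_def)
  have "\<bar>clarke_deriv (\<phi> x) (z x) (v x)\<bar> \<le> c * (norm (v x) + (norm (z x))\<^sup>2 + (norm (v x))\<^sup>2)" for x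
  proof -
    have "(1 + norm (z x)) * norm (v x) \<le> norm (v x) + (norm (z x))\<^sup>2 + (norm (v x))\<^sup>2"
      using zero_le_power2[of "norm (z x) - norm (v x)"]
        mult_nonneg_nonneg[OF norm_ge_zero norm_ge_zero, of "z x" "v x"]
      unfolding power2_diff distrib_right mult_1 by linarith
    then have "c * ((1 + norm (z x)) * norm (v x)) \<le> c * (norm (v x) + (norm (z x))\<^sup>2 + (norm (v x))\<^sup>2)"
      using c_nonneg by (rule mult_left_mono)
    then show ?thesis
      using clarke_deriv_growth[OF locally_lipschitz_phi growth, of x "z x" "v x"] by (simp add: mult.assoc)
  qed
  then show "AE x in M. norm (clarke_deriv (\<phi> x) (z x) (v x))
      \<le> norm (c * (norm (v x) + (norm (z x))\<^sup>2 + (norm (v x))\<^sup>2))"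
    by (intro AE_I2) (simp add: order_trans[OF _ abs_ge_self])
qed

abbreviation functional :: "('a \<Rightarrow> 'b) \<Rightarrow> real" where
  "functional z \<equiv> \<integral>x. \<phi> x (z x) \<partial>M"

lemma functional_quotient:
  assumes "y \<in> L2 M" "v \<in> L2 M"
  shows "(functional (\<lambda>x. y x + h *\<^sub>R v x) - functional y) / h
      = (\<integral>x. difference_quotient (\<phi> x) (v x) (y x) h \<partial>M)"
    and "integrable M (\<lambda>x. difference_quotient (\<phi> x) (v x) (y x) h)"
proof -
  have "integrable M (\<lambda>x. \<phi> x (y x + h *\<^sub>R v x))"
    by (intro comp_integrable L2_add L2_scaleR assms)
  then show "(functional (\<lambda>x. y x + h *\<^sub>R v x) - functional y) / h
      = (\<integral>x. difference_quotient (\<phi> x) (v x) (y x) h \<partial>M)"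
    and "integrable M (\<lambda>x. difference_quotient (\<phi> x) (v x) (y x) h)"
    using comp_integrable[OF assms(1)] by (simp_all add: difference_quotient_def)
qed

lemma functional_quotient_bounded:
  assumes "z \<in> L2 M" "v \<in> L2 M"
  shows "\<exists>K. \<forall>\<^sub>F (y, h) in seminorm_nhds (L2 M) (L2_norm M) z \<times>\<^sub>F at_right 0.
     \<bar>(functional (\<lambda>x. y x + h *\<^sub>R v x) - functional y) / h\<bar> \<le> K"
  unfolding eventually_seminorm_nhds_at_right
proof (rule exI[of _ "c * ((\<integral>x. norm (v x) \<partial>M) + 2 * (\<integral>x. (norm (z x))\<^sup>2 \<partial>M)
      + 2 * 1 + 2 * (\<integral>x. (norm (v x))\<^sup>2 \<partial>M))"], intro exI[of _ 1] conjI allI impI)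
  fix y h assume a: "(y \<in> L2 M \<and> L2_norm M (\<lambda>x. y x - z x) < 1) \<and> 0 < h \<and> h < (1::real)"
  then have yL: "y \<in> L2 M" by simp
  have d: "(\<lambda>x. y x - z x) \<in> L2 M" using L2_diff[OF yL assms(1)] .
  have 1: "integrable M (\<lambda>x. norm (v x))" "integrable M (\<lambda>x. (norm (z x))\<^sup>2)"
    "integrable M (\<lambda>x. (norm (y x - z x))\<^sup>2)" "integrable M (\<lambda>x. (norm (v x))\<^sup>2)"
    using L2_integrable_norm[OF assms(2)] assms d by (auto simp: L2_def)
  have "\<bar>\<integral>x. difference_quotient (\<phi> x) (v x) (y x) h \<partial>M\<bar>
      \<le> (\<integral>x. c * (norm (v x) + 2 * (norm (z x))\<^sup>2 + 2 * (norm (y x - z x))\<^sup>2 + 2 * (norm (v x))\<^sup>2) \<partial>M)"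
    using functional_quotient(2)[OF yL assms(2), of h] 1 a
    by (intro order_trans[OF integral_abs_bound] integral_mono) (auto intro!: quotient_bound)
  also have "\<dots> = c * ((\<integral>x. norm (v x) \<partial>M) + 2 * (\<integral>x. (norm (z x))\<^sup>2 \<partial>M)
      + 2 * (L2_norm M (\<lambda>x. y x - z x))\<^sup>2 + 2 * (\<integral>x. (norm (v x))\<^sup>2 \<partial>M))"
    using 1 by (simp add: L2_norm_power2)
  also have "\<dots> \<le> c * ((\<integral>x. norm (v x) \<partial>M) + 2 * (\<integral>x. (norm (z x))\<^sup>2 \<partial>M)
      + 2 * 1 + 2 * (\<integral>x. (norm (v x))\<^sup>2 \<partial>M))"
    using a L2_norm_nonneg[of M "\<lambda>x. y x - z x"] by (intro mult_left_mono c_nonneg add_mono) (auto simp: power_le_one)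
  finally show "case (y, h) of (y, h) \<Rightarrow> \<bar>(functional (\<lambda>x. y x + h *\<^sub>R v x) - functional y) / h\<bar>
     \<le> c * ((\<integral>x. norm (v x) \<partial>M) + 2 * (\<integral>x. (norm (z x))\<^sup>2 \<partial>M)
      + 2 * 1 + 2 * (\<integral>x. (norm (v x))\<^sup>2 \<partial>M))"
    using functional_quotient(1)[OF yL assms(2), of h] by simp
qed simp

lemma functional_quotient_eventually_le:
  assumes "z \<in> L2 M" "v \<in> L2 M" and "e > 0"
  shows "\<forall>\<^sub>F (y, h) in seminorm_nhds (L2 M) (L2_norm M) z \<times>\<^sub>F at_right 0.
     (functional (\<lambda>x. y x + h *\<^sub>R v x) - functional y) / h
       \<le> (\<integral>x. clarke_deriv (\<phi> x) (z x) (v x) \<partial>M) + e" (is "eventually ?P ?F")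
proof (rule ccontr)
  let ?I = "\<integral>x. clarke_deriv (\<phi> x) (z x) (v x) \<partial>M"
  assume neg: "\<not> eventually ?P ?F"
  define R where "R k w h \<longleftrightarrow> w \<in> L2 M \<and> L2_norm M (\<lambda>x. w x - z x) < (1/2)^k \<and> 0 < h \<and> h < (1/2)^k \<and>
      ?I + e < (functional (\<lambda>x. w x + h *\<^sub>R v x) - functional w) / h" for k :: nat and w h
  have "\<exists>w h. R k w h" for k
  proof (rule ccontr)
    assume no: "\<not> ?thesis"
    have "eventually ?P ?F"
      unfolding eventually_seminorm_nhds_at_right
    proof (intro exI[of _ "(1/2)^k"] conjI allI impI)
      fix w h assume a: "(w \<in> L2 M \<and> L2_norm M (\<lambda>x. w x - z x) < (1/2)^k) \<and> 0 < h \<and> h < (1/2::real)^k"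
      have "\<not> ?I + e < (functional (\<lambda>x. w x + h *\<^sub>R v x) - functional w) / h"
      proof
        assume "?I + e < (functional (\<lambda>x. w x + h *\<^sub>R v x) - functional w) / h"
        then have "R k w h" unfolding R_def using a by simp
        then show False using no by blast
      qed
      then show "?P (w, h)" by (simp only: case_prod_conv not_less)
    qed simp
    then show False using neg by contradiction
  qed
  then obtain w h where R: "\<And>k. R k (w k) (h k)" by metis
  then have w: "\<And>k. w k \<in> L2 M" "\<And>k. L2_norm M (\<lambda>x. w k x - z x) < (1/2)^k"
    and h: "\<And>k. 0 < h k" "\<And>k. h k < (1/2)^k"
    and large: "\<And>k. ?I + e < (functional (\<lambda>x. w k x + h k *\<^sub>R v x) - functional (w k)) / h k"
    unfolding R_def by simp_all
  define q where "q k x = difference_quotient (\<phi> x) (v x) (w k x) (h k)" for k x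
  define d where "d x = clarke_deriv (\<phi> x) (z x) (v x)" for x
  define S where "S x = (\<Sum>k. (norm (w k x - z x))\<^sup>2)" for x
  have h1: "h k \<le> 1" for k using h(2)[of k] power_le_one[of "1/2::real" k] by simp
  have "h \<longlonglongrightarrow> 0"
    by (rule tendsto_sandwich[OF _ _ tendsto_const LIMSEQ_realpow_zero[of "1/2"]])
      (auto intro!: always_eventually less_imp_le h)
  have "summable (\<lambda>k. (L2_norm M (\<lambda>x. w k x - z x))\<^sup>2)"
  proof (rule summable_comparison_test')
    show "summable (\<lambda>k. (1/2::real)^k)" by (rule summable_geometric) simp
    fix k assume "k \<ge> (0::nat)"
    have "(L2_norm M (\<lambda>x. w k x - z x))\<^sup>2 \<le> ((1/2)^k)\<^sup>2"
      using w(2)[of k] by (intro power_mono L2_norm_nonneg) auto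
    also have "\<dots> \<le> (1/2)^k" by (simp add: power2_eq_square mult_left_le_one_le power_le_one)
    finally show "norm ((L2_norm M (\<lambda>x. w k x - z x))\<^sup>2) \<le> (1/2)^k" by simp
  qed
  note sumAE = summable_L2_AE[OF L2_diff[OF w(1) assms(1)] this]
  have qint: "integrable M (q k)" for k
    unfolding q_def by (rule functional_quotient(2)[OF w(1) assms(2)])
  have dint: "integrable M d" unfolding d_def by (rule clarke_integrable[OF assms(1,2)])
  have "(\<lambda>k. \<integral>x. max (q k x) (d x) \<partial>M) \<longlonglongrightarrow> (\<integral>x. d x \<partial>M)"
  proof (rule integral_dominated_convergence)
    show "integrable M (\<lambda>x. c * (norm (v x) + 2 * (norm (z x))\<^sup>2 + 2 * S x + 2 * (norm (v x))\<^sup>2) + \<bar>d x\<bar>)"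
      using L2_integrable_norm[OF assms(2)] assms(1,2) sumAE(2) dint by (auto simp: L2_def S_def)
    show "d \<in> borel_measurable M" using dint by auto
    show "(\<lambda>x. max (q k x) (d x)) \<in> borel_measurable M" for k
      using qint dint by (intro borel_measurable_max) auto
    show "AE x in M. (\<lambda>k. max (q k x) (d x)) \<longlonglongrightarrow> d x"
      using sumAE(1)
    proof eventually_elim
      case (elim x)
      have "(\<lambda>k. sqrt ((norm (w k x - z x))\<^sup>2)) \<longlonglongrightarrow> sqrt 0"
        using elim by (intro tendsto_real_sqrt summable_LIMSEQ_zero)
      then have "(\<lambda>k. w k x) \<longlonglongrightarrow> z x" by (simp add: LIM_zero_iff tendsto_norm_zero_iff)
      show ?case
      proof (rule LIMSEQ_I)
        fix r :: real assume "r > 0"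
        then have "clarke_deriv (\<phi> x) (z x) (v x) < d x + r" by (simp add: d_def)
        from clarke_deriv_less[OF locally_lipschitz_phi this] obtain s where s: "s > 0"
          "\<And>y h. dist y (z x) < s \<Longrightarrow> 0 < h \<Longrightarrow> h < s \<Longrightarrow> difference_quotient (\<phi> x) (v x) y h < d x + r"
          unfolding eventually_nhds_at_right by auto
        have "\<forall>\<^sub>F k in sequentially. dist (w k x) (z x) < s \<and> h k < s"
          using tendstoD[OF \<open>(\<lambda>k. w k x) \<longlonglongrightarrow> z x\<close> s(1)] order_tendstoD(2)[OF \<open>h \<longlonglongrightarrow> 0\<close> s(1)]
          by (rule eventually_conj)
        then have "\<forall>\<^sub>F k in sequentially. norm (max (q k x) (d x) - d x) < r"
        proof eventually_elim
          case (elim k)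
          then have "q k x < d x + r" unfolding q_def using h(1) by (intro s(2)) auto
          then show ?case using \<open>r > 0\<close> by (auto simp: max_def)
        qed
        then show "\<exists>n0. \<forall>n\<ge>n0. norm (max (q n x) (d x) - d x) < r"
          by (simp add: eventually_sequentially)
      qed
    qed
    show "AE x in M. norm (max (q k x) (d x))
        \<le> c * (norm (v x) + 2 * (norm (z x))\<^sup>2 + 2 * S x + 2 * (norm (v x))\<^sup>2) + \<bar>d x\<bar>" for k
      using sumAE(1)
    proof eventually_elim
      case (elim x)
      have "(norm (w k x - z x))\<^sup>2 \<le> S x"
        unfolding S_def using sum_le_suminf[OF elim, of "{k}"] by simp
      then have "c * (norm (v x) + 2 * (norm (z x))\<^sup>2 + 2 * (norm (w k x - z x))\<^sup>2 + 2 * (norm (v x))\<^sup>2)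
        \<le> c * (norm (v x) + 2 * (norm (z x))\<^sup>2 + 2 * S x + 2 * (norm (v x))\<^sup>2)"
        by (intro mult_left_mono c_nonneg) auto
      moreover have "\<bar>q k x\<bar> \<le> c * (norm (v x) + 2 * (norm (z x))\<^sup>2 + 2 * (norm (w k x - z x))\<^sup>2 + 2 * (norm (v x))\<^sup>2)"
        unfolding q_def by (rule quotient_bound[OF h(1) h1])
      ultimately show ?case by (auto simp: max_def)
    qed
  qed
  moreover have "?I + e \<le> (\<integral>x. max (q k x) (d x) \<partial>M)" for k
  proof -
    have "?I + e \<le> (\<integral>x. q k x \<partial>M)"
      using large[of k] functional_quotient(1)[OF w(1) assms(2)] by (simp add: q_def)
    also have "\<dots> \<le> (\<integral>x. max (q k x) (d x) \<partial>M)"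
      using qint dint by (intro integral_mono) (auto intro!: integrable_max)
    finally show ?thesis .
  qed
  ultimately have "?I + e \<le> (\<integral>x. d x \<partial>M)"
    by (intro LIMSEQ_le_const) auto
  then show False using assms(3) by (simp add: d_def)
qed

lemma clarke_deriv_functional_le:
  assumes "z \<in> L2 M" "v \<in> L2 M"
  shows "clarke_deriv_on (L2 M) (L2_norm M) functional z v
    \<le> (\<integral>x. clarke_deriv (\<phi> x) (z x) (v x) \<partial>M)"
proof (rule field_le_epsilon)
  fix e :: real assume "e > 0"
  let ?F = "seminorm_nhds (L2 M) (L2_norm M) z \<times>\<^sub>F at_right (0::real)"
  have "seminorm_nhds (L2 M) (L2_norm M) z \<noteq> bot"
    unfolding trivial_limit_def eventually_seminorm_nhds using assms(1)
    by (auto simp: L2_norm_def)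
  then have "?F \<noteq> bot" by (simp add: prod_filter_eq_bot)
  moreover obtain K where "\<forall>\<^sub>F (y, h) in ?F.
      \<bar>(functional (\<lambda>x. y x + h *\<^sub>R v x) - functional y) / h\<bar> \<le> K"
    using functional_quotient_bounded[OF assms] by blast
  ultimately show "clarke_deriv_on (L2 M) (L2_norm M) functional z v
      \<le> (\<integral>x. clarke_deriv (\<phi> x) (z x) (v x) \<partial>M) + e"
    using functional_quotient_eventually_le[OF assms \<open>e > 0\<close>] unfolding clarke_deriv_on_def case_prod_unfold
    by (rule real_Limsup_le)
qed

end

section \<open>The Hausdorff measure on Lipschitz boundaries\<close>

lemma hausdorff_content_antimono:
  assumes "\<delta> \<le> \<delta>'"
  shows "hausdorff_content s \<delta>' A \<le> hausdorff_content s \<delta> A"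
  unfolding hausdorff_content_def using assms by (intro Inf_superset_mono) (blast intro: order_trans)

lemma hausdorff_content_add_le:
  fixes A B :: "'a::metric_space set"
  assumes s: "s > 0" and \<delta>: "\<delta> > 0" and sep: "\<And>x y. x \<in> A \<Longrightarrow> y \<in> B \<Longrightarrow> \<delta> < dist x y"
  shows "hausdorff_content s \<delta> A + hausdorff_content s \<delta> B \<le> hausdorff_content s \<delta> (A \<union> B)"
  unfolding hausdorff_content_def[of s \<delta> "A \<union> B"]
proof (rule Inf_greatest, clarify)
  let ?f = "\<lambda>C :: 'a set. ennreal (unit_ball_vol (real s) * (diameter C / 2) ^ s)"
  fix C :: "nat \<Rightarrow> 'a set"
  assume cover: "A \<union> B \<subseteq> (\<Union>n. C n)" and C: "\<forall>n. bounded (C n) \<and> diameter (C n) \<le> \<delta>"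
  define D where "D X n = (if C n \<inter> X = {} then {} else C n)" for X n
  have D: "hausdorff_content s \<delta> X \<le> (\<Sum>n. ?f (D X n))" if "X \<subseteq> A \<union> B" for X
  proof -
    have "X \<subseteq> (\<Union>n. D X n)" using cover that unfolding D_def by fastforce
    then show ?thesis
      unfolding hausdorff_content_def using C \<delta>
      by (intro Inf_lower CollectI exI[of _ "D X"]) (auto simp: D_def)
  qed
  have "hausdorff_content s \<delta> A + hausdorff_content s \<delta> B \<le> (\<Sum>n. ?f (D A n)) + (\<Sum>n. ?f (D B n))"
    by (intro add_mono D) auto
  also have "\<dots> = (\<Sum>n. ?f (D A n) + ?f (D B n))" by (intro suminf_add) auto
  also have "\<dots> \<le> (\<Sum>n. ?f (C n))"
  proof (intro suminf_le)
    fix n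
    have "C n \<inter> A = {} \<or> C n \<inter> B = {}"
    proof (rule ccontr)
      assume "\<not> ?thesis"
      then obtain x y where xy: "x \<in> C n" "x \<in> A" "y \<in> C n" "y \<in> B" by blast
      have "\<delta> < dist x y" using xy by (intro sep)
      also have "dist x y \<le> diameter (C n)"
        using C xy by (intro diameter_bounded_bound) auto
      finally show False using C by (meson leD)
    qed
    then show "?f (D A n) + ?f (D B n) \<le> ?f (C n)"
      using s by (auto simp: D_def zero_power)
  qed auto
  finally show "hausdorff_content s \<delta> A + hausdorff_content s \<delta> B \<le> (\<Sum>n. ?f (C n))" .
qed

lemma hausdorff_outer_add_le:
  fixes A B :: "'a::metric_space set"
  assumes s: "s > 0" and \<eta>: "\<eta> > 0" and sep: "\<And>x y. x \<in> A \<Longrightarrow> y \<in> B \<Longrightarrow> \<eta> \<le> dist x y"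
  shows "hausdorff_outer s A + hausdorff_outer s B \<le> hausdorff_outer s (A \<union> B)"
proof -
  have le: "hausdorff_content s d A + hausdorff_content s d' B \<le> hausdorff_outer s (A \<union> B)"
    if "d > 0" "d' > 0" for d d'
  proof -
    let ?m = "min (min d d') (\<eta> / 2)"
    have "hausdorff_content s d A + hausdorff_content s d' B
        \<le> hausdorff_content s ?m A + hausdorff_content s ?m B"
      by (intro add_mono hausdorff_content_antimono) auto
    also have "\<dots> \<le> hausdorff_content s ?m (A \<union> B)"
      using that \<eta> sep by (intro hausdorff_content_add_le s) (auto simp: min_def intro: less_le_trans, fastforce+)
    also have "\<dots> \<le> hausdorff_outer s (A \<union> B)"
      using that \<eta> by (auto simp: hausdorff_outer_def intro!: SUP_upper)
    finally show ?thesis .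
  qed
  have "hausdorff_content s d A + hausdorff_outer s B \<le> hausdorff_outer s (A \<union> B)" if "d > 0" for d
    unfolding hausdorff_outer_def[of s B]
    by (subst ennreal_SUP_add_right) (auto intro!: SUP_least le that)
  then show ?thesis
    unfolding hausdorff_outer_def[of s A]
    by (subst ennreal_SUP_add_left[symmetric]) (auto intro!: SUP_least)
qed

context
  fixes s :: nat
  assumes s: "s > 0"
begin

lemma hausdorff_outer_empty: "hausdorff_outer s ({} :: 'a::metric_space set) = 0"
  using outer_measure_space_hausdorff[OF s, where 'a='a]
  by (auto simp: outer_measure_space_def positive_def)

lemma hausdorff_outer_mono: "A \<subseteq> B \<Longrightarrow> hausdorff_outer s A \<le> hausdorff_outer s (B :: 'a::metric_space set)"
  using outer_measure_space_hausdorff[OF s, where 'a='a]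
  by (auto simp: outer_measure_space_def increasing_def)

lemma hausdorff_outer_countable_subadd:
  "hausdorff_outer s (\<Union>i. A i :: 'a::metric_space set) \<le> (\<Sum>i. hausdorff_outer s (A i))"
  unfolding hausdorff_outer_def[of s "\<Union>i. A i"]
proof (rule SUP_least)
  fix \<delta> :: real assume "\<delta> \<in> {0<..}"
  then have "(\<Sum>i. hausdorff_content s \<delta> (A i)) \<le> (\<Sum>i. hausdorff_outer s (A i))"
    by (intro suminf_le) (auto simp: hausdorff_outer_def intro: SUP_upper)
  with hausdorff_content_subadd[of s \<delta> A]
  show "hausdorff_content s \<delta> (\<Union>i. A i) \<le> (\<Sum>i. hausdorff_outer s (A i))"
    by (rule order_trans)
qed

lemma hausdorff_outer_subadd:
  "hausdorff_outer s (A \<union> B :: 'a::metric_space set) \<le> hausdorff_outer s A + hausdorff_outer s B"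
proof -
  have "hausdorff_outer s (\<Union>i. binaryset A B i) \<le> (\<Sum>i. hausdorff_outer s (binaryset A B i))"
    by (rule hausdorff_outer_countable_subadd)
  then show ?thesis
    by (simp add: UN_binaryset_eq suminf_binaryset_eq hausdorff_outer_empty)
qed

lemma hausdorff_outer_finite_Union:
  assumes "finite I" and "\<And>i. i \<in> I \<Longrightarrow> hausdorff_outer s (A i :: 'a::metric_space set) < \<infinity>"
  shows "hausdorff_outer s (\<Union>i\<in>I. A i) < \<infinity>"
  using assms
proof (induction I rule: finite_induct)
  case (insert i I)
  then show ?case
    using hausdorff_outer_subadd[of "A i" "\<Union>i\<in>I. A i"] by (simp add: order_le_less_trans)
qed (simp add: hausdorff_outer_empty)

text \<open>Alternate shells around a closed set are at positive distance from each other.\<close>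

lemma hausdorff_outer_shells:
  fixes F A :: "'a::metric_space set"
  defines "D \<equiv> \<lambda>j::nat. {x\<in>A. 1 / real (j + 2) \<le> infdist x F \<and> infdist x F < 1 / real (j + 1)}"
  shows "(\<Sum>j<n. hausdorff_outer s (D (2 * j + b))) \<le> hausdorff_outer s A"
proof -
  have "(\<Sum>j<n. hausdorff_outer s (D (2 * j + b))) \<le> hausdorff_outer s (\<Union>j<n. D (2 * j + b))"
  proof (induction n)
    case 0
    then show ?case by (simp add: hausdorff_outer_empty)
  next
    case (Suc n)
    have "hausdorff_outer s (\<Union>j<n. D (2 * j + b)) + hausdorff_outer s (D (2 * n + b))
        \<le> hausdorff_outer s ((\<Union>j<n. D (2 * j + b)) \<union> D (2 * n + b))"
    proof (cases "n = 0")
      case False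
      let ?r = "real (2 * n + b)"
      have r: "?r > 0" using False by simp
      show ?thesis
      proof (rule hausdorff_outer_add_le[OF s, of "1 / ?r - 1 / (?r + 1)"])
        show "0 < 1 / ?r - 1 / (?r + 1)" using r by (simp add: divide_strict_left_mono)
        fix x y assume "x \<in> (\<Union>j<n. D (2 * j + b))" and y: "y \<in> D (2 * n + b)"
        then obtain j where j: "j < n" "x \<in> D (2 * j + b)" by blast
        have "1 / ?r \<le> 1 / real (2 * j + b + 2)" using j(1) by (intro divide_left_mono) auto
        then have "1 / ?r \<le> infdist x F" using j(2) by (simp add: D_def)
        moreover have "infdist y F < 1 / (?r + 1)" using y by (simp add: D_def add_ac)
        moreover have "infdist x F \<le> infdist y F + dist x y" by (rule infdist_triangle)
        ultimately show "1 / ?r - 1 / (?r + 1) \<le> dist x y" by linarith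
      qed
    qed (simp add: hausdorff_outer_empty)
    moreover have "(\<Union>j<n. D (2 * j + b)) \<union> D (2 * n + b) = (\<Union>j<Suc n. D (2 * j + b))"
      by (auto simp: less_Suc_eq)
    ultimately show ?case using Suc by (simp add: add_right_mono order_trans[OF add_right_mono])
  qed
  also have "\<dots> \<le> hausdorff_outer s A" by (intro hausdorff_outer_mono) (auto simp: D_def)
  finally show ?thesis .
qed

lemma hausdorff_outer_closed_split:
  fixes F A :: "'a::metric_space set"
  assumes "closed F" "F \<noteq> {}" and fin: "hausdorff_outer s A < \<infinity>"
  shows "hausdorff_outer s (A \<inter> F) + hausdorff_outer s (A - F) \<le> hausdorff_outer s A"
proof -
  let ?H = "hausdorff_outer s :: 'a set \<Rightarrow> ennreal"
  define D where "D j = {x\<in>A. 1 / real (j + 2) \<le> infdist x F \<and> infdist x F < 1 / real (j + 1)}" for j :: nat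
  define A' where "A' k = {x\<in>A. 1 / real (k + 1) \<le> infdist x F}" for k :: nat
  have finD: "?H (D j) < top" for j
    using hausdorff_outer_mono[of "D j" A] fin by (auto simp: D_def)
  define g where "g j = enn2real (?H (D j))" for j
  have Hg: "?H (D j) = ennreal (g j)" for j using finD by (simp add: g_def)
  have g0: "g j \<ge> 0" for j by (simp add: g_def)
  have "(\<Sum>j<n. g j) \<le> 2 * enn2real (?H A)" for n
  proof -
    have "(\<Sum>j<n. g j) \<le> (\<Sum>j<2*n. g j)" by (intro sum_mono2 g0) auto
    also have "\<dots> = (\<Sum>j<n. g (2 * j)) + (\<Sum>j<n. g (2 * j + 1))"
      by (induction n) auto
    finally have split: "(\<Sum>j<n. g j) \<le> (\<Sum>j<n. g (2 * j)) + (\<Sum>j<n. g (2 * j + 1))" .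
    have "(\<Sum>j<n. g (2 * j + b)) \<le> enn2real (?H A)" for b
    proof -
      have "ennreal (\<Sum>j<n. g (2 * j + b)) = (\<Sum>j<n. ?H (D (2 * j + b)))"
        by (simp add: Hg g0)
      also have "\<dots> \<le> ?H A"
        using hausdorff_outer_shells[where A = A and F = F and b = b and n = n] by (simp add: D_def)
      also have "?H A = ennreal (enn2real (?H A))" using fin by simp
      finally show ?thesis by (simp add: ennreal_le_iff)
    qed
    from this[of 0] this[of 1] split show ?thesis by simp
  qed
  then have "summable g" by (intro summableI_nonneg_bounded g0)
  have dec: "A - F \<subseteq> A' k \<union> (\<Union>j. D (j + k))" for k
  proof
    fix x assume x: "x \<in> A - F"
    then have pos: "infdist x F > 0"
      using infdist_nonneg[of x F] in_closed_iff_infdist_zero[OF assms(1,2), of x] by auto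
    show "x \<in> A' k \<union> (\<Union>j. D (j + k))"
    proof (cases "x \<in> A' k")
      case False
      define m where "m = (LEAST m. 1 / real (m + 1) \<le> infdist x F)"
      obtain m0 :: nat where "1 / real (Suc m0) < infdist x F" using nat_approx_posE[OF pos] by auto
      then have "1 / real (m0 + 1) \<le> infdist x F" by simp
      then have m: "1 / real (m + 1) \<le> infdist x F" unfolding m_def by (rule LeastI)
      have "k < m"
      proof (rule ccontr)
        assume "\<not> k < m"
        then have "1 / real (k + 1) \<le> 1 / real (m + 1)" by (intro divide_left_mono) auto
        then show False using False x m by (auto simp: A'_def)
      qed
      then have "\<not> 1 / real ((m - 1) + 1) \<le> infdist x F"
        unfolding m_def by (intro not_less_Least) auto
      moreover have "(m - 1 - k) + k + 2 = m + 1" "(m - 1 - k) + k + 1 = (m - 1) + 1"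
        using \<open>k < m\<close> by auto
      ultimately have "x \<in> D ((m - 1 - k) + k)"
        unfolding D_def mem_Collect_eq using x m by simp
      then show ?thesis by blast
    qed simp
  qed
  show ?thesis
  proof (rule ennreal_le_epsilon)
    fix e :: real assume "e > 0"
    obtain k where k: "norm (\<Sum>j. g (j + k)) < e"
      using suminf_exist_split[OF \<open>e > 0\<close> \<open>summable g\<close>] by blast
    have "?H (\<Union>j. D (j + k)) \<le> (\<Sum>j. ?H (D (j + k)))" by (rule hausdorff_outer_countable_subadd)
    also have "\<dots> = ennreal (\<Sum>j. g (j + k))"
      unfolding Hg using \<open>summable g\<close> by (intro suminf_ennreal2 g0) (simp add: summable_iff_shift)
    also have "\<dots> \<le> ennreal e" using k by (intro ennreal_leI) auto
    finally have tail: "?H (\<Union>j. D (j + k)) \<le> ennreal e" .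
    have "?H (A - F) \<le> ?H (A' k) + ?H (\<Union>j. D (j + k))"
      using hausdorff_outer_mono[OF dec[of k]] hausdorff_outer_subadd[of "A' k" "\<Union>j. D (j + k)"]
      by (rule order_trans)
    also have "\<dots> \<le> ?H (A' k) + ennreal e" using tail by (rule add_left_mono)
    finally have "?H (A \<inter> F) + ?H (A - F) \<le> ?H (A \<inter> F) + (?H (A' k) + ennreal e)"
      by (rule add_left_mono)
    also have "\<dots> = (?H (A \<inter> F) + ?H (A' k)) + ennreal e" by (simp add: add.assoc)
    also have "?H (A \<inter> F) + ?H (A' k) \<le> ?H ((A \<inter> F) \<union> A' k)"
    proof (rule hausdorff_outer_add_le[OF s, of "1 / real (k + 1)"])
      fix x y assume "x \<in> A \<inter> F" "y \<in> A' k"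
      then show "1 / real (k + 1) \<le> dist x y"
        using infdist_le[of x F y] by (simp add: A'_def dist_commute)
    qed simp
    also have "\<dots> \<le> ?H A" by (intro hausdorff_outer_mono) (auto simp: A'_def)
    finally show "?H (A \<inter> F) + ?H (A - F) \<le> ?H A + ennreal e" by (simp add: add_right_mono)
  qed
qed

lemma closed_in_hausdorff_lambda_system:
  fixes F :: "'a::metric_space set"
  assumes "closed F"
  shows "F \<in> lambda_system UNIV UNIV (hausdorff_outer s)"
proof -
  have "hausdorff_outer s (F \<inter> A) + hausdorff_outer s (- F \<inter> A) = hausdorff_outer s A" for A
  proof (rule antisym)
    show "hausdorff_outer s (F \<inter> A) + hausdorff_outer s (- F \<inter> A) \<le> hausdorff_outer s A"
    proof (cases "F = {} \<or> hausdorff_outer s A = \<infinity>")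
      case True
      then show ?thesis by (auto simp: hausdorff_outer_empty)
    next
      case False
      then show ?thesis
        using hausdorff_outer_closed_split[OF assms, of A]
        by (simp add: Int_commute Diff_eq less_top)
    qed
    have "F \<inter> A \<union> - F \<inter> A = A" by blast
    then show "hausdorff_outer s A \<le> hausdorff_outer s (F \<inter> A) + hausdorff_outer s (- F \<inter> A)"
      using hausdorff_outer_subadd[of "F \<inter> A" "- F \<inter> A"] by simp
  qed
  then show ?thesis by (simp add: lambda_system_def Compl_eq_Diff_UNIV)
qed

end

lemma hausdorff_content_finite_cover:
  assumes s: "s > 0" and "finite I" and "A \<subseteq> (\<Union>i\<in>I. B i)" and \<delta>: "0 \<le> b" "b \<le> \<delta>"
    and B: "\<And>i. i \<in> I \<Longrightarrow> bounded (B i) \<and> diameter (B i) \<le> b"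
  shows "hausdorff_content s \<delta> A \<le> ennreal (real (card I) * (unit_ball_vol (real s) * (b / 2) ^ s))"
proof -
  let ?f = "\<lambda>C. ennreal (unit_ball_vol (real s) * (diameter C / 2) ^ s)"
  obtain h where h: "bij_betw h {..<card I} I"
    using assms(2) by (metis bij_betw_from_nat_into_finite)
  define C where "C n = (if n < card I then B (h n) else {})" for n
  have hI: "h n \<in> I" if "n < card I" for n using h that by (auto simp: bij_betw_def)
  have "A \<subseteq> (\<Union>n. C n)"
  proof
    fix x assume "x \<in> A"
    then obtain i where i: "i \<in> I" "x \<in> B i" using assms(3) by blast
    then have "i \<in> h ` {..<card I}" using h by (simp add: bij_betw_def)
    then obtain n where "n < card I" "h n = i" by blast
    then show "x \<in> (\<Union>n. C n)" using i by (auto simp: C_def intro!: exI[of _ n])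
  qed
  moreover have "bounded (C n) \<and> diameter (C n) \<le> \<delta>" for n
    using B[OF hI[of n]] \<delta> by (auto simp: C_def)
  ultimately have "hausdorff_content s \<delta> A \<le> (\<Sum>n. ?f (C n))"
    unfolding hausdorff_content_def by (intro Inf_lower) blast
  also have "\<dots> = (\<Sum>n<card I. ?f (C n))"
    using s by (intro suminf_finite) (auto simp: C_def)
  also have "\<dots> \<le> (\<Sum>n<card I. ennreal (unit_ball_vol (real s) * (b / 2) ^ s))"
    using B[OF hI]
    by (intro sum_mono ennreal_leI mult_left_mono power_mono divide_right_mono)
      (auto simp: C_def diameter_ge_0)
  also have "\<dots> = ennreal (real (card I) * (unit_ball_vol (real s) * (b / 2) ^ s))"
    using \<delta> by (simp add: ennreal_mult ennreal_of_nat_eq_real_of_nat)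
  finally show ?thesis .
qed

lemma nat_floor_eq_imp_close:
  fixes a b :: real
  assumes "0 \<le> a" "0 \<le> b" "nat \<lfloor>a\<rfloor> = nat \<lfloor>b\<rfloor>"
  shows "\<bar>a - b\<bar> \<le> 1"
  using assms by linarith

lemma hausdorff_outer_lipschitz_graph:
  fixes x e :: "real^'n"
  assumes card: "CARD('n) \<ge> 2" and e: "norm e = 1" and g: "L-lipschitz_on {z. z \<bullet> e = 0} g"
    and \<rho>: "\<rho> > 0"
  shows "hausdorff_outer (CARD('n) - 1) ((\<lambda>z. x + z + g z *\<^sub>R e) ` {z. z \<bullet> e = 0 \<and> norm z < \<rho>}) < \<infinity>"
proof -
  let ?s = "CARD('n) - 1"
  let ?A = "(\<lambda>z. x + z + g z *\<^sub>R e) ` {z. z \<bullet> e = 0 \<and> norm z < \<rho>}"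
  obtain k :: 'n where True by blast
  obtain f :: "real^'n \<Rightarrow> real^'n" where f: "orthogonal_transformation f" "f (axis k 1) = e"
    using orthogonal_transformation_exists_1[of "axis k 1 :: real^'n" e] e by (auto simp: norm_axis_1)
  define G where "G y = x + f y + g (f y) *\<^sub>R e" for y
  have perp: "f y \<bullet> e = 0 \<longleftrightarrow> y $ k = 0" for y
    using f by (metis inner_axis orthogonal_transformation_def inner_real_def mult.right_neutral)
  have L: "L \<ge> 0" using g by (rule lipschitz_on_nonneg)
  have Glip: "dist (G y) (G y') \<le> (1 + L) * norm (y - y')" if "y $ k = 0" "y' $ k = 0" for y y'
  proof -
    have "dist (g (f y)) (g (f y')) \<le> L * dist (f y) (f y')"
      using that perp by (intro lipschitz_onD[OF g]) auto
    also have "dist (f y) (f y') = norm (y - y')"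
      using f(1) by (metis dist_norm orthogonal_transformation_isometry)
    finally have 1: "\<bar>g (f y) - g (f y')\<bar> \<le> L * norm (y - y')" by (simp add: dist_real_def)
    have "dist (G y) (G y') \<le> norm (f y - f y') + norm ((g (f y) - g (f y')) *\<^sub>R e)"
      unfolding G_def dist_norm
      by (rule order_trans[OF _ norm_triangle_ineq]) (simp add: algebra_simps)
    also have "norm (f y - f y') = norm (y - y')"
      using f(1) by (metis dist_norm orthogonal_transformation_isometry)
    also have "norm ((g (f y) - g (f y')) *\<^sub>R e) \<le> L * norm (y - y')" using 1 e by simp
    finally show ?thesis by (simp add: distrib_right)
  qed
  define K where "K = (1 + L) * (real CARD('n) * (2 * \<rho>))"
  have K: "K \<ge> 0" unfolding K_def using L \<rho> by (intro mult_nonneg_nonneg) auto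
  have "hausdorff_content ?s \<delta> ?A \<le> ennreal (unit_ball_vol (real ?s) * (K / 2) ^ ?s)" if "\<delta> > 0" for \<delta>
  proof -
    obtain m :: nat where m: "m > 0" "K / real m \<le> \<delta>"
    proof -
      obtain m :: nat where "K / \<delta> < real m" using reals_Archimedean2 by blast
      moreover have "0 \<le> K / \<delta>" using K \<open>\<delta> > 0\<close> by simp
      ultimately have "real m > 0" by linarith
      then have "K / real m \<le> \<delta>" using \<open>K / \<delta> < real m\<close> \<open>\<delta> > 0\<close> by (simp add: field_simps)
      then show ?thesis using that \<open>real m > 0\<close> by simp
    qed
    define t where "t y i = (y $ i + \<rho>) * real m / (2 * \<rho>)" for y :: "real^'n" and i
    define I where "I = (UNIV - {k}) \<rightarrow>\<^sub>E {..<m}"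
    define B where "B \<kappa> = G ` {y. y $ k = 0 \<and> norm y < \<rho> \<and> (\<forall>i. i \<noteq> k \<longrightarrow> nat \<lfloor>t y i\<rfloor> = \<kappa> i)}" for \<kappa>
    have t0: "0 \<le> t y i" "t y i < real m" if "norm y < \<rho>" for y i
    proof -
      have "\<bar>y $ i\<bar> < \<rho>" using component_le_norm_cart[of y i] that by simp
      then have "y $ i + \<rho> \<ge> 0" "y $ i + \<rho> < 2 * \<rho>" by auto
      then have "0 \<le> (y $ i + \<rho>) * real m" "(y $ i + \<rho>) * real m < 2 * \<rho> * real m"
        using m(1) by (auto intro!: mult_strict_right_mono)
      then show "0 \<le> t y i" "t y i < real m" using \<rho> by (auto simp: t_def field_simps)
    qed
    have "hausdorff_content ?s \<delta> ?A \<le> ennreal (real (card I) * (unit_ball_vol (real ?s) * (K / real m / 2) ^ ?s))"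
    proof (rule hausdorff_content_finite_cover)
      show "?s > 0" using card by simp
      show "finite I" by (simp add: I_def finite_PiE)
      show "0 \<le> K / real m" "K / real m \<le> \<delta>" using K m by auto
      show "?A \<subseteq> (\<Union>\<kappa>\<in>I. B \<kappa>)"
      proof
        fix p assume "p \<in> ?A"
        then obtain z where z: "p = x + z + g z *\<^sub>R e" "z \<bullet> e = 0" "norm z < \<rho>" by blast
        obtain y where y: "z = f y" using orthogonal_transformation_surj[OF f(1)] by (metis surjD)
        have ny: "norm y < \<rho>" using z(3) y f(1) by (simp add: orthogonal_transformation_norm)
        define \<kappa> where "\<kappa> = restrict (\<lambda>i. nat \<lfloor>t y i\<rfloor>) (UNIV - {k})"
        have "\<kappa> \<in> I" using t0[OF ny] unfolding \<kappa>_def I_def by (auto simp: floor_less_iff nat_less_iff)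
        moreover have "p \<in> B \<kappa>"
          using z y perp ny by (auto simp: B_def G_def \<kappa>_def intro!: imageI)
        ultimately show "p \<in> (\<Union>\<kappa>\<in>I. B \<kappa>)" by blast
      qed
      fix \<kappa>
      have close: "dist p q \<le> K / real m" if pq: "p \<in> B \<kappa>" "q \<in> B \<kappa>" for p q
      proof -
        obtain y y' where p: "p = G y" "y $ k = 0" "norm y < \<rho>" "\<And>i. i \<noteq> k \<Longrightarrow> nat \<lfloor>t y i\<rfloor> = \<kappa> i"
          and q: "q = G y'" "y' $ k = 0" "norm y' < \<rho>" "\<And>i. i \<noteq> k \<Longrightarrow> nat \<lfloor>t y' i\<rfloor> = \<kappa> i"
          using pq unfolding B_def by blast
        have "\<bar>(y - y') $ i\<bar> \<le> 2 * \<rho> / real m" for i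
        proof (cases "i = k")
          case False
          then have "\<bar>t y i - t y' i\<bar> \<le> 1"
            using p(4) q(4) by (intro nat_floor_eq_imp_close t0 p(3) q(3)) auto
          moreover have "t y i - t y' i = (y - y') $ i * (real m / (2 * \<rho>))"
            using \<rho> by (simp add: t_def field_simps)
          ultimately have "\<bar>(y - y') $ i\<bar> * (real m / (2 * \<rho>)) \<le> 1"
            using \<rho> by (simp add: abs_mult)
          then show ?thesis using \<rho> m(1) by (simp add: field_simps)
        qed (use p q \<rho> in simp)
        then have "norm (y - y') \<le> (\<Sum>i\<in>(UNIV :: 'n set). 2 * \<rho> / real m)"
          by (intro order_trans[OF norm_le_l1_cart] sum_mono)
        then have "(1 + L) * norm (y - y') \<le> K / real m"
          using L by (simp add: K_def mult_left_mono flip: times_divide_eq_right)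
        then show ?thesis using Glip[OF p(2) q(2)] p(1) q(1) by simp
      qed
      have "bounded (B \<kappa>)"
        using close by (auto simp: bounded_two_points)
      moreover have "diameter (B \<kappa>) \<le> K / real m"
        using K close by (intro diameter_le) (auto simp: dist_norm)
      ultimately show "bounded (B \<kappa>) \<and> diameter (B \<kappa>) \<le> K / real m" ..
    qed
    also have "card I = m ^ ?s" by (simp add: I_def card_PiE card_Diff_singleton)
    also have "real (m ^ ?s) * (unit_ball_vol (real ?s) * (K / real m / 2) ^ ?s)
        = unit_ball_vol (real ?s) * (K / 2) ^ ?s"
      using m(1) by (simp add: power_divide)
    finally show ?thesis .
  qed
  then have "hausdorff_outer ?s ?A \<le> ennreal (unit_ball_vol (real ?s) * (K / 2) ^ ?s)"
    unfolding hausdorff_outer_def by (intro SUP_least) auto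
  then show ?thesis by (simp add: order_le_less_trans)
qed

lemma frontier_subset_lipschitz_graph:
  fixes \<Omega> :: "'a::euclidean_space set"
  assumes "open \<Omega>" and e: "norm e = 1" and g: "L-lipschitz_on {z. z \<bullet> e = 0} g" and "r > 0" "h > 0"
    and graph: "\<And>z s. z \<bullet> e = 0 \<Longrightarrow> norm z < r \<Longrightarrow> \<bar>s\<bar> < h \<Longrightarrow> x + z + s *\<^sub>R e \<in> \<Omega> \<longleftrightarrow> g z < s"
  shows "frontier \<Omega> \<inter> ball x (min r h) \<subseteq> (\<lambda>z. x + z + g z *\<^sub>R e) ` {z. z \<bullet> e = 0 \<and> norm z < r}"
proof
  fix y assume y: "y \<in> frontier \<Omega> \<inter> ball x (min r h)"
  define s where "s y = (y - x) \<bullet> e" for y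
  define z where "z y = (y - x) - s y *\<^sub>R e" for y
  have ee: "e \<bullet> e = 1" using e by (simp add: norm_eq_1)
  have dec: "x + z y + s y *\<^sub>R e = y" for y by (simp add: z_def)
  have ze: "z y \<bullet> e = 0" for y by (simp add: z_def s_def inner_diff_left ee)
  have sb: "\<bar>s y\<bar> \<le> norm (y - x)" for y
    using Cauchy_Schwarz_ineq2[of "y - x" e] e by (simp add: s_def)
  have zb: "norm (z y) \<le> norm (y - x)" for y
  proof -
    have "(norm (z y))\<^sup>2 = (norm (y - x))\<^sup>2 - (s y)\<^sup>2"
      unfolding z_def power2_norm_eq_inner
      by (simp add: inner_diff_left inner_diff_right s_def ee inner_commute power2_eq_square algebra_simps)
    then have "(norm (z y))\<^sup>2 \<le> (norm (y - x))\<^sup>2" by simp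
    then show ?thesis by (rule power2_le_imp_le) simp
  qed
  have small: "norm (z y) < r \<and> \<bar>s y\<bar> < h" if "y \<in> ball x (min r h)" for y
    using that sb[of y] zb[of y] by (simp add: dist_norm norm_minus_commute)
  have iff: "y \<in> \<Omega> \<longleftrightarrow> g (z y) < s y" if "y \<in> ball x (min r h)" for y
    using graph[OF ze, of y "s y"] small[OF that] dec[of y] by simp
  have "\<not> g (z y) < s y"
    using iff y \<open>open \<Omega>\<close> by (auto simp: frontier_def interior_open)
  moreover have "\<not> s y < g (z y)"
  proof
    assume "s y < g (z y)"
    have "continuous_on UNIV z" unfolding z_def s_def by (intro continuous_intros)
    then have "continuous_on UNIV (\<lambda>y. g (z y))"
      by (rule continuous_on_compose2[OF lipschitz_on_continuous_on[OF g]]) (use ze in blast)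
    then have "open ({y. s y < g (z y)} \<inter> ball x (min r h))"
      unfolding s_def by (intro open_Int open_Collect_less continuous_intros) auto
    moreover have "y \<in> {y. s y < g (z y)} \<inter> ball x (min r h)" using y \<open>s y < g (z y)\<close> by simp
    moreover have "({y. s y < g (z y)} \<inter> ball x (min r h)) \<inter> \<Omega> = {}" using iff by auto
    ultimately have "y \<notin> closure \<Omega>" by (metis disjoint_iff open_Int_closure_eq_empty)
    then show False using y by (simp add: frontier_def)
  qed
  ultimately have "y = x + z y + g (z y) *\<^sub>R e" using dec[of y] by (simp add: not_less antisym)
  then show "y \<in> (\<lambda>z. x + z + g z *\<^sub>R e) ` {z. z \<bullet> e = 0 \<and> norm z < r}"
    using ze small[of y] y by blast
qed

lemma hausdorff_outer_lipschitz_frontier: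
  fixes \<Omega> :: "(real^'n) set"
  assumes card: "CARD('n) \<ge> 2" and dom: "bounded_lipschitz_domain \<Omega>"
  shows "hausdorff_outer (CARD('n) - 1) (frontier \<Omega>) < \<infinity>"
proof -
  have s: "CARD('n) - 1 > 0" using card by simp
  have "open \<Omega>" "bounded \<Omega>" and lip: "lipschitz_boundary \<Omega>"
    using dom by (auto simp: bounded_lipschitz_domain_def)
  have "\<exists>d>0. hausdorff_outer (CARD('n) - 1) (frontier \<Omega> \<inter> ball x d) < \<infinity>" if x: "x \<in> frontier \<Omega>" for x
  proof -
    obtain e r h L g where *: "norm e = 1" "0 < r" "0 < h" "L-lipschitz_on {z. z \<bullet> e = 0} g"
      "\<And>z s. z \<bullet> e = 0 \<Longrightarrow> norm z < r \<Longrightarrow> \<bar>s\<bar> < h \<Longrightarrow> x + z + s *\<^sub>R e \<in> \<Omega> \<longleftrightarrow> g z < s"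
      using lip[unfolded lipschitz_boundary_def, rule_format, OF x] by (elim exE conjE) blast
    note hausdorff_outer_mono[OF s frontier_subset_lipschitz_graph[OF \<open>open \<Omega>\<close> *(1,4,2,3,5)]]
    also note hausdorff_outer_lipschitz_graph[OF card *(1,4,2)]
    finally show ?thesis using *(2,3) by (intro exI[of _ "min r h"]) auto
  qed
  then obtain d where d: "\<And>x. x \<in> frontier \<Omega> \<Longrightarrow> d x > 0 \<and>
      hausdorff_outer (CARD('n) - 1) (frontier \<Omega> \<inter> ball x (d x)) < \<infinity>"
    by metis
  have "compact (frontier \<Omega>)" using \<open>bounded \<Omega>\<close> by (rule compact_frontier_bounded)
  moreover have "frontier \<Omega> \<subseteq> (\<Union>x\<in>frontier \<Omega>. ball x (d x))" using d by fastforce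
  ultimately obtain F where F: "F \<subseteq> frontier \<Omega>" "finite F" "frontier \<Omega> \<subseteq> (\<Union>x\<in>F. ball x (d x))"
    using compactE_image[of "frontier \<Omega>" "frontier \<Omega>" "\<lambda>x. ball x (d x)"] by auto
  have "hausdorff_outer (CARD('n) - 1) (frontier \<Omega>)
      \<le> hausdorff_outer (CARD('n) - 1) (\<Union>x\<in>F. frontier \<Omega> \<inter> ball x (d x))"
    using F(3) by (intro hausdorff_outer_mono[OF s]) blast
  also have "\<dots> < \<infinity>" using F d by (intro hausdorff_outer_finite_Union[OF s]) auto
  finally show ?thesis .
qed

lemma space_surface_measure: "space surface_measure = UNIV"
  by (simp add: surface_measure_def Let_def space_measure_of_conv)

lemma borel_subset_surface_measure:
  assumes "CARD('n) \<ge> 2"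
  shows "sets borel \<subseteq> sets (surface_measure :: (real^'n) measure)"
proof -
  have "sigma_sets UNIV {F. closed F} \<subseteq> sets (surface_measure :: (real^'n) measure)"
    using sets.sigma_sets_subset[of "{F. closed F}" "surface_measure :: (real^'n) measure"]
      closed_in_hausdorff_lambda_system[of "CARD('n) - 1"] assms
    by (auto simp: surface_measure_facts(1) space_surface_measure)
  then show ?thesis by (simp add: borel_eq_closed)
qed

lemma complete_surface_measure:
  assumes "CARD('n) \<ge> 2"
  shows "complete_measure (surface_measure :: (real^'n) measure)"
proof
  let ?H = "hausdorff_outer (CARD('n) - 1) :: (real^'n) set \<Rightarrow> ennreal"
  have s: "CARD('n) - 1 > 0" using assms by simp
  fix A B :: "(real^'n) set" assume "B \<subseteq> A" and "A \<in> null_sets surface_measure"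
  then have "?H A = 0" using assms by (auto simp: null_sets_def surface_measure_facts)
  have null: "?H X = 0" if "X \<subseteq> A" for X
    using hausdorff_outer_mono[OF s that] \<open>?H A = 0\<close> by simp
  have "?H (B \<inter> X) + ?H ((UNIV - B) \<inter> X) = ?H X" for X
  proof -
    have "?H X \<le> ?H (B \<inter> X) + ?H ((UNIV - B) \<inter> X)"
      using hausdorff_outer_subadd[OF s, of "B \<inter> X" "(UNIV - B) \<inter> X"]
      by (metis Int_Un_distrib2 Un_Diff_cancel Un_UNIV_right inf_top_left)
    moreover have "?H (B \<inter> X) = 0" using \<open>B \<subseteq> A\<close> by (intro null) auto
    moreover have "?H ((UNIV - B) \<inter> X) \<le> ?H X" by (intro hausdorff_outer_mono[OF s]) auto
    ultimately show ?thesis by (simp add: antisym)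
  qed
  then show "B \<in> sets surface_measure"
    using assms by (simp add: surface_measure_facts(1) lambda_system_def)
qed

section \<open>Measurability of the outward normal\<close>

lemma outward_normal_unique:
  fixes \<Omega> :: "'a::euclidean_space set"
  assumes m: "is_outward_normal \<Omega> x m" and n: "is_outward_normal \<Omega> x n"
  shows "m = n"
proof (rule ccontr)
  assume "m \<noteq> n"
  have norms: "norm m = 1" "norm n = 1" using m n by (auto simp: is_outward_normal_def)
  define c where "c = 1 - m \<bullet> n"
  have "(norm (n - m))\<^sup>2 = 2 * c"
    using norms by (simp add: c_def power2_norm_eq_inner inner_diff inner_commute norm_eq_1)
  then have "c > 0" using \<open>m \<noteq> n\<close> by (smt (verit) right_minus_eq zero_less_norm_iff zero_less_power)
  define \<epsilon> where "\<epsilon> = c / (2 * norm (n - m))"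
  have nm: "norm (n - m) > 0" using \<open>m \<noteq> n\<close> by simp
  then have "\<epsilon> > 0" using \<open>c > 0\<close> by (simp add: \<epsilon>_def)
  then obtain \<delta>1 \<delta>2 where d: "\<delta>1 > 0" "\<delta>2 > 0"
    and d1: "\<And>y. norm (y - x) < \<delta>1 \<Longrightarrow> (y - x) \<bullet> m < - \<epsilon> * norm (y - x) \<Longrightarrow> y \<in> \<Omega>"
    and d2: "\<And>y. norm (y - x) < \<delta>2 \<Longrightarrow> (y - x) \<bullet> n > \<epsilon> * norm (y - x) \<Longrightarrow> y \<notin> \<Omega>"
    using m n unfolding is_outward_normal_def by metis
  define s where "s = min \<delta>1 \<delta>2 / (2 * norm (n - m))"
  have s: "s > 0" using d nm by (simp add: s_def)
  define y where "y = x + s *\<^sub>R (n - m)"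
  have yx: "norm (y - x) = s * norm (n - m)" using s by (simp add: y_def)
  have small: "s * norm (n - m) < \<delta>1" "s * norm (n - m) < \<delta>2"
    using nm d by (auto simp: s_def)
  have eps: "\<epsilon> * norm (y - x) = s * c / 2" using nm by (simp add: yx \<epsilon>_def)
  have "(y - x) \<bullet> m = - (s * c)" "(y - x) \<bullet> n = s * c"
    using norms by (auto simp: y_def c_def inner_diff inner_commute norm_eq_1 algebra_simps)
  then show False
    using d1[of y] d2[of y] small yx eps mult_pos_pos[OF s \<open>c > 0\<close>] by auto
qed

lemma outward_normal_eq:
  assumes "is_outward_normal \<Omega> x n"
  shows "outward_normal \<Omega> x = n"
  using assms outward_normal_unique unfolding outward_normal_def by (auto intro!: the_equality)

lemma norm_outward_normal_le: "norm (outward_normal \<Omega> x) \<le> 1"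
proof (cases "\<exists>n. is_outward_normal \<Omega> x n")
  case True
  then obtain n where n: "is_outward_normal \<Omega> x n" by blast
  then show ?thesis using outward_normal_eq[OF n] by (simp add: is_outward_normal_def)
qed (simp add: outward_normal_def)

definition nearly_normal :: "'a::euclidean_space set \<Rightarrow> real \<Rightarrow> real \<Rightarrow> 'a \<Rightarrow> 'a \<Rightarrow> bool" where
  "nearly_normal \<Omega> \<epsilon> \<delta> x n \<longleftrightarrow> (\<forall>y. norm (y - x) < \<delta> \<longrightarrow>
     ((y - x) \<bullet> n < - \<epsilon> * norm (y - x) \<longrightarrow> y \<in> \<Omega>) \<and>
     ((y - x) \<bullet> n > \<epsilon> * norm (y - x) \<longrightarrow> y \<notin> \<Omega>))"

lemma closed_nearly_normal: "closed {p. nearly_normal \<Omega> \<epsilon> \<delta> (snd p) (fst p)}"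
proof -
  have "- {p. nearly_normal \<Omega> \<epsilon> \<delta> (snd p) (fst p)} =
    (\<Union>y\<in>-\<Omega>. {p. norm (y - snd p) < \<delta> \<and> (y - snd p) \<bullet> fst p < - \<epsilon> * norm (y - snd p)}) \<union>
    (\<Union>y\<in>\<Omega>. {p. norm (y - snd p) < \<delta> \<and> \<epsilon> * norm (y - snd p) < (y - snd p) \<bullet> fst p})"
    unfolding nearly_normal_def by auto
  also have "open \<dots>"
    by (intro open_Un open_UN ballI open_Collect_conj open_Collect_less continuous_intros)
  finally show ?thesis by (simp add: closed_def)
qed

lemma nearly_normal_perturb:
  assumes "nearly_normal \<Omega> \<epsilon> \<delta> x n" and "\<epsilon> + norm (m - n) \<le> \<epsilon>'"
  shows "nearly_normal \<Omega> \<epsilon>' \<delta> x m"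
proof -
  have "\<bar>(y - x) \<bullet> m - (y - x) \<bullet> n\<bar> \<le> norm (m - n) * norm (y - x)" for y
    using Cauchy_Schwarz_ineq2[of "y - x" "m - n"] by (simp add: inner_diff_right mult.commute)
  moreover have "\<epsilon> * norm (y - x) + norm (m - n) * norm (y - x) \<le> \<epsilon>' * norm (y - x)" for y
    using mult_right_mono[OF assms(2), of "norm (y - x)"] by (simp add: distrib_right)
  ultimately show ?thesis
    using assms(1) unfolding nearly_normal_def
    by (smt (verit) mult_minus_left)
qed

text \<open>
  By compactness of the unit sphere, approximate normals at all scales \<open>1 / Suc m\<close> have a limit,
  and the limit is a normal; this makes the set a countable combination of closed sets.
\<close>

lemma exists_outward_normal_eq:
  fixes \<Omega> :: "'a::euclidean_space set"
  assumes "closed C"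
  shows "{x. \<exists>n\<in>C. is_outward_normal \<Omega> x n} =
    (\<Inter>m::nat. \<Union>k::nat. {x. \<exists>n\<in>C \<inter> sphere 0 1. nearly_normal \<Omega> (1 / Suc m) (1 / Suc k) x n})"
    (is "?L = ?R")
proof (intro set_eqI iffI)
  fix x assume "x \<in> ?L"
  then obtain n where n: "n \<in> C" "is_outward_normal \<Omega> x n" by blast
  have "\<exists>k. nearly_normal \<Omega> (1 / Suc m) (1 / Suc k) x n" for m :: nat
  proof -
    have "(1::real) / Suc m > 0" by simp
    then obtain \<delta> where \<delta>: "\<delta> > 0" "nearly_normal \<Omega> (1 / Suc m) \<delta> x n"
      using n(2) unfolding is_outward_normal_def nearly_normal_def by blast
    obtain k :: nat where "1 / Suc k < \<delta>" using nat_approx_posE[OF \<delta>(1)] by auto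
    then have "nearly_normal \<Omega> (1 / Suc m) (1 / Suc k) x n"
      using \<delta>(2) unfolding nearly_normal_def by force
    then show ?thesis ..
  qed
  moreover have "n \<in> C \<inter> sphere 0 1" using n by (simp add: is_outward_normal_def)
  ultimately show "x \<in> ?R" by blast
next
  fix x assume "x \<in> ?R"
  then have "\<forall>m::nat. \<exists>n k. n \<in> C \<inter> sphere 0 1 \<and> nearly_normal \<Omega> (1 / Suc m) (1 / Suc (k::nat)) x n"
    by blast
  then obtain n k where nk: "\<And>m. n m \<in> C \<inter> sphere 0 1"
      "\<And>m. nearly_normal \<Omega> (1 / Suc m) (1 / Suc (k m :: nat)) x (n m)"
    by metis
  have "compact (C \<inter> sphere 0 1)" using assms by (intro closed_Int_compact) auto
  then obtain l r where l: "l \<in> C \<inter> sphere 0 1" "strict_mono r" "(n \<circ> r) \<longlonglongrightarrow> l"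
    using nk(1) unfolding compact_def by blast
  have "\<exists>\<delta>>0. nearly_normal \<Omega> \<epsilon> \<delta> x l" if "\<epsilon> > 0" for \<epsilon>
  proof -
    have "\<forall>\<^sub>F i in sequentially. dist ((n \<circ> r) i) l < \<epsilon> / 2"
      using \<open>\<epsilon> > 0\<close> by (intro tendstoD[OF l(3)]) simp
    moreover have "\<forall>\<^sub>F i in sequentially. 1 / real (Suc i) < \<epsilon> / 2"
      using LIMSEQ_Suc[OF lim_1_over_n] \<open>\<epsilon> > 0\<close> by (intro order_tendstoD) auto
    ultimately have "\<forall>\<^sub>F i in sequentially. dist ((n \<circ> r) i) l < \<epsilon> / 2 \<and> 1 / real (Suc i) < \<epsilon> / 2"
      by (rule eventually_conj)
    then obtain i where i: "dist (n (r i)) l < \<epsilon> / 2" "1 / real (Suc i) < \<epsilon> / 2"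
      by (auto simp: eventually_sequentially)
    have "1 / real (Suc (r i)) \<le> 1 / real (Suc i)"
      using seq_suble[OF l(2), of i] by (simp add: frac_le)
    then have "1 / real (Suc (r i)) + norm (l - n (r i)) \<le> \<epsilon>"
      using i by (simp add: dist_norm norm_minus_commute)
    from nearly_normal_perturb[OF nk(2) this] show ?thesis
      by (intro exI[of _ "1 / real (Suc (k (r i)))"]) simp
  qed
  then have "is_outward_normal \<Omega> x l"
    using l(1) unfolding is_outward_normal_def nearly_normal_def by auto
  then show "x \<in> ?L" using l(1) by blast
qed

lemma exists_outward_normal_borel:
  fixes \<Omega> :: "'a::euclidean_space set"
  assumes "closed C"
  shows "{x. \<exists>n\<in>C. is_outward_normal \<Omega> x n} \<in> sets borel"
proof -
  have "closed {x. \<exists>n\<in>C \<inter> sphere 0 1. nearly_normal \<Omega> \<epsilon> \<delta> x n}" for \<epsilon> \<delta>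
  proof -
    have "compact (C \<inter> sphere (0::'a) 1)" using assms by (intro closed_Int_compact) auto
    from closed_compact_projection[OF this closed_nearly_normal, of \<Omega> \<epsilon> \<delta>]
    show ?thesis by (simp add: Bex_def)
  qed
  then show ?thesis unfolding exists_outward_normal_eq[OF assms]
    by (intro sets.countable_INT'' sets.countable_UN'' borel_closed) auto
qed

lemma outward_normal_borel_measurable: "outward_normal \<Omega> \<in> borel_measurable borel"
proof (rule borel_measurableI)
  fix U :: "'a set" assume U: "open U"
  let ?E = "\<lambda>C. {x. \<exists>n\<in>C. is_outward_normal \<Omega> x n}"
  have "x \<in> outward_normal \<Omega> -` U \<longleftrightarrow> x \<notin> ?E (- U) \<union> (if 0 \<in> U then {} else - ?E UNIV)" for x
  proof (cases "\<exists>n. is_outward_normal \<Omega> x n")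
    case True
    then obtain n where n: "is_outward_normal \<Omega> x n" by blast
    then have "is_outward_normal \<Omega> x m \<longleftrightarrow> m = n" for m using outward_normal_unique by blast
    then show ?thesis using outward_normal_eq[OF n] by simp
  qed (auto simp: outward_normal_def split: if_splits)
  then have "outward_normal \<Omega> -` U \<inter> space borel = - (?E (- U) \<union> (if 0 \<in> U then {} else - ?E UNIV))"
    by auto
  also have "\<dots> \<in> sets borel"
    using exists_outward_normal_borel[of "- U"] exists_outward_normal_borel[OF closed_UNIV] U
    by (auto intro!: sets.Un borel_comp)
  finally show "outward_normal \<Omega> -` U \<inter> space borel \<in> sets borel" .
qed

section \<open>Sections of the superpotential at fixed time\<close>

lemma (in complete_measure) borel_measurable_cong_AE:
  fixes f g :: "'a \<Rightarrow> 'b::topological_space"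
  assumes g: "g \<in> borel_measurable M" and ae: "AE x in M. f x = g x"
  shows "f \<in> borel_measurable M"
proof (rule measurableI)
  fix A :: "'b set" assume A: "A \<in> sets borel"
  have "AE x in M. x \<in> g -` A \<inter> space M \<longleftrightarrow> x \<in> f -` A \<inter> space M"
    using ae by eventually_elim auto
  then show "f -` A \<inter> space M \<in> sets M"
    using measurable_sets[OF g A] by (rule in_sets_AE) auto
qed simp

lemma (in pair_sigma_finite) AE_pair_swap:
  assumes "AE x in M1 \<Otimes>\<^sub>M M2. Q x"
  shows "AE y in M2. AE x in M1. Q (x, y)"
proof -
  interpret Q: pair_sigma_finite M2 M1 ..
  have "AE p in distr (M2 \<Otimes>\<^sub>M M1) (M1 \<Otimes>\<^sub>M M2) (\<lambda>(x, y). (y, x)). Q p"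
    using assms by (subst (asm) distr_pair_swap)
  then have "AE p in M2 \<Otimes>\<^sub>M M1. Q (case p of (x, y) \<Rightarrow> (y, x))"
    by (rule AE_distrD[OF measurable_pair_swap'])
  from Q.AE_pair[OF this] show ?thesis by simp
qed

lemma (in pair_sigma_finite) AE_completion_section:
  assumes "AE p in completion (M1 \<Otimes>\<^sub>M M2). Q p"
  shows "AE y in M2. AE x in M1. Q (x, y)"
  using assms by (intro AE_pair_swap) (simp add: AE_completion_iff)

lemma (in pair_sigma_finite) measurable_completion_section:
  fixes f :: "'a \<times> 'b \<Rightarrow> real"
  assumes "complete_measure M1" and f: "f \<in> borel_measurable (completion (M1 \<Otimes>\<^sub>M M2))"
  shows "AE y in M2. (\<lambda>x. f (x, y)) \<in> borel_measurable M1"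
proof -
  interpret M1: complete_measure M1 by fact
  obtain f' where f'[measurable]: "f' \<in> borel_measurable (M1 \<Otimes>\<^sub>M M2)"
    and ae: "AE p in M1 \<Otimes>\<^sub>M M2. f p = f' p"
    using completion_ex_borel_measurable_real[OF f] by blast
  have "AE y in M2. AE x in M1. f (x, y) = f' (x, y)" using ae by (rule AE_pair_swap)
  then show ?thesis
    using AE_space
  proof eventually_elim
    case (elim y)
    have "(\<lambda>x. f' (x, y)) \<in> borel_measurable M1" using elim(2) by measurable
    then show ?case using elim(1) by (rule M1.borel_measurable_cong_AE)
  qed
qed

lemma (in complete_measure) integral_cong_AE_complete:
  fixes f g :: "'a \<Rightarrow> real"
  assumes ae: "AE x in M. f x = g x"
  shows "integral\<^sup>L M f = integral\<^sup>L M g"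
proof (cases "g \<in> borel_measurable M")
  case True
  then have "f \<in> borel_measurable M" by (rule borel_measurable_cong_AE) (use ae in auto)
  then show ?thesis using True ae by (intro integral_cong_AE)
next
  case False
  have "f \<notin> borel_measurable M"
  proof
    assume "f \<in> borel_measurable M"
    then have "g \<in> borel_measurable M" by (rule borel_measurable_cong_AE) (use ae in \<open>eventually_elim, simp\<close>)
    then show False using False by contradiction
  qed
  then show ?thesis using False
    by (metis borel_measurable_integrable not_integrable_integral_eq)
qed

lemma locally_lipschitz_const: "locally_lipschitz (\<lambda>_. c)"
  unfolding locally_lipschitz_def using lipschitz_on_constant zero_less_one by blast

lemma clarke_subdiff_const: "clarke_subdiff (\<lambda>_::'a::euclidean_space. c) u = {0}"
proof -
  have "clarke_deriv (\<lambda>_::'a. c) u v \<le> 0" for v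
    by (rule clarke_deriv_le[OF locally_lipschitz_const]) (simp add: difference_quotient_def case_prod_unfold)
  then have "\<xi> = 0" if "\<xi> \<in> clarke_subdiff (\<lambda>_::'a. c) u" for \<xi>
    using that unfolding clarke_subdiff_def
    by (metis inner_gt_zero_iff leD mem_Collect_eq order_trans)
  moreover obtain \<eta> where "\<eta> \<in> clarke_subdiff (\<lambda>_::'a. c) u"
    using clarke_subdiff_attains[OF locally_lipschitz_const] by metis
  ultimately show ?thesis by auto
qed

text \<open>
  Measurability is only required on a countable dense set of values of the last variable:
  continuity extends it to all values, and completeness absorbs the null set where the
  pointwise hypotheses fail.
\<close>

lemma superpotential_integrand_modification:
  fixes \<psi> :: "'a \<Rightarrow> 'b::euclidean_space \<Rightarrow> real"
  assumes "finite_measure M" and "complete_measure M"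
    and D: "closure D = UNIV" "\<And>\<xi>. \<xi> \<in> D \<Longrightarrow> (\<lambda>x. \<psi> x \<xi>) \<in> borel_measurable M"
    and base: "\<exists>\<xi>\<^sub>0\<in>L2 M. integrable M (\<lambda>x. \<psi> x (\<xi>\<^sub>0 x))"
    and lip: "AE x in M. locally_lipschitz (\<psi> x)"
    and c: "0 \<le> c"
    and growth: "AE x in M. \<forall>\<xi>. \<forall>\<eta>\<in>clarke_subdiff (\<psi> x) \<xi>. norm \<eta> \<le> c * (1 + norm \<xi>)"
  obtains \<phi> where "superpotential_integrand M \<phi> c" "AE x in M. \<phi> x = \<psi> x"
proof -
  interpret finite_measure M by fact
  interpret complete_measure M by fact
  define good where "good x \<longleftrightarrow> locally_lipschitz (\<psi> x) \<and>
      (\<forall>\<xi>. \<forall>\<eta>\<in>clarke_subdiff (\<psi> x) \<xi>. norm \<eta> \<le> c * (1 + norm \<xi>))" for x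
  define \<phi> where "\<phi> x = (if good x then \<psi> x else (\<lambda>_. 0))" for x
  have ae: "AE x in M. \<phi> x = \<psi> x"
    using lip growth by eventually_elim (simp add: \<phi>_def good_def)
  have lip': "locally_lipschitz (\<phi> x)" for x
    using locally_lipschitz_const by (auto simp: \<phi>_def good_def)
  have measD: "(\<lambda>x. \<phi> x \<xi>) \<in> borel_measurable M" if "\<xi> \<in> D" for \<xi>
    using D(2)[OF that] by (rule borel_measurable_cong_AE) (use ae in \<open>eventually_elim, simp\<close>)
  have meas: "(\<lambda>x. \<phi> x \<xi>) \<in> borel_measurable M" for \<xi>
  proof -
    obtain d where d: "\<And>n. d n \<in> D" "d \<longlonglongrightarrow> \<xi>"
      using D(1) unfolding closure_sequential set_eq_iff by auto
    show ?thesis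
    proof (rule borel_measurable_LIMSEQ_real)
      show "(\<lambda>x. \<phi> x (d n)) \<in> borel_measurable M" for n by (rule measD[OF d(1)])
      show "(\<lambda>n. \<phi> x (d n)) \<longlonglongrightarrow> \<phi> x \<xi>" for x
        using d(2) locally_lipschitz_continuous[OF lip', of UNIV x]
        by (intro isCont_tendsto_compose[of _ "\<phi> x"]) (auto simp: continuous_on_eq_continuous_at)
    qed
  qed
  obtain \<xi>\<^sub>0 where xi: "\<xi>\<^sub>0 \<in> L2 M" "integrable M (\<lambda>x. \<psi> x (\<xi>\<^sub>0 x))" using base by blast
  have "(\<lambda>x. \<phi> x (\<xi>\<^sub>0 x)) \<in> borel_measurable M"
    using xi(1) by (intro caratheodory_measurable[OF locally_lipschitz_continuous[OF lip'] meas]) (simp add: L2_def)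
  then have "integrable M (\<lambda>x. \<phi> x (\<xi>\<^sub>0 x))"
    by (rule integrable_cong_AE_imp[OF xi(2)]) (use ae in \<open>eventually_elim, simp\<close>)
  then have base': "\<exists>\<xi>\<^sub>0\<in>L2 M. integrable M (\<lambda>x. \<phi> x (\<xi>\<^sub>0 x))" using xi(1) by blast
  have "\<forall>\<xi>. \<forall>\<eta>\<in>clarke_subdiff (\<phi> x) \<xi>. norm \<eta> \<le> c * (1 + norm \<xi>)" for x
    using c by (cases "good x") (simp_all add: \<phi>_def good_def clarke_subdiff_const)
  then have "superpotential_integrand M \<phi> c"
    using meas base' lip' c
    by (intro superpotential_integrand.intro superpotential_integrand_axioms.intro assms(1))
  then show ?thesis using ae by (rule that)
qed

lemma Psi_deriv_le_integral:
  fixes \<Gamma> :: "(real^'n) set"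
  assumes "finite_measure (surface_on \<Gamma>)" and "complete_measure (surface_on \<Gamma>)"
    and sup: "superpotential \<Gamma> T \<psi>"
  shows "AE t in lebesgue_on {0<..<T}. \<forall>z\<in>L2 (surface_on \<Gamma>). \<forall>w\<in>L2 (surface_on \<Gamma>).
    Psi_deriv \<Gamma> \<psi> t z w \<le> (\<integral>x. clarke_deriv (\<psi> x t) (z x) (w x) \<partial>surface_on \<Gamma>)"
proof -
  let ?M = "surface_on \<Gamma>" and ?N = "lebesgue_on {0<..<T}"
  interpret M: finite_measure ?M by fact
  interpret M: complete_measure ?M by fact
  interpret N: finite_measure ?N by (intro finite_measure_lebesgue_on) simp
  interpret P: pair_sigma_finite ?M ?N ..
  obtain D :: "(real^'n) set" where D: "countable D" "\<And>X. open X \<Longrightarrow> X \<noteq> {} \<Longrightarrow> \<exists>d\<in>D. d \<in> X"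
    using countable_dense_setE by blast
  have "- closure D = {}"
  proof (rule ccontr)
    assume "- closure D \<noteq> {}"
    then obtain d where "d \<in> D" "d \<in> - closure D" using D(2)[of "- closure D"] by auto
    then show False using closure_subset[of D] by blast
  qed
  then have dense: "closure D = UNIV" by blast
  have joint: "\<forall>\<xi>. (\<lambda>(x, t). \<psi> x t \<xi>) \<in> borel_measurable (completion (?M \<Otimes>\<^sub>M ?N))"
    and lip_joint: "AE (x, t) in completion (?M \<Otimes>\<^sub>M ?N). locally_lipschitz (\<psi> x t)"
    using sup unfolding superpotential_def space_time_def by blast+
  have meas: "AE t in ?N. (\<lambda>x. \<psi> x t \<xi>) \<in> borel_measurable ?M" for \<xi>
    using P.measurable_completion_section[OF assms(2) joint[rule_format, of \<xi>]] by simp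
  obtain \<xi>\<^sub>0 where xi: "\<xi>\<^sub>0 \<in> L2 ?M" "AE t in ?N. integrable ?M (\<lambda>x. \<psi> x t (\<xi>\<^sub>0 x))"
    using sup unfolding superpotential_def by blast
  have lip: "AE t in ?N. AE x in ?M. locally_lipschitz (\<psi> x t)"
    using P.AE_completion_section[OF lip_joint] by simp
  obtain c where c: "c > 0" "AE (x, t) in space_time \<Gamma> T.
      \<forall>\<xi>. \<forall>\<eta>\<in>clarke_subdiff (\<psi> x t) \<xi>. norm \<eta> \<le> c * (1 + norm \<xi>)"
    using sup unfolding superpotential_def by blast
  have growth: "AE t in ?N. AE x in ?M. \<forall>\<xi>. \<forall>\<eta>\<in>clarke_subdiff (\<psi> x t) \<xi>. norm \<eta> \<le> c * (1 + norm \<xi>)"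
    using P.AE_completion_section[OF c(2)[unfolded space_time_def]] by simp
  have "AE t in ?N. \<forall>\<xi>\<in>D. (\<lambda>x. \<psi> x t \<xi>) \<in> borel_measurable ?M"
    using meas D(1) by (simp add: AE_ball_countable)
  then show ?thesis
    using xi(2) lip growth
  proof eventually_elim
    case (elim t)
    have "\<exists>\<xi>\<^sub>0\<in>L2 ?M. integrable ?M (\<lambda>x. \<psi> x t (\<xi>\<^sub>0 x))" using xi(1) elim(2) by blast
    then obtain \<phi> where \<phi>: "superpotential_integrand ?M \<phi> c" "AE x in ?M. \<phi> x = \<psi> x t"
      using superpotential_integrand_modification[OF assms(1,2) dense elim(1)[rule_format] _ elim(3)
          less_imp_le[OF c(1)] elim(4)] by blast
    interpret superpotential_integrand ?M \<phi> c by (rule \<phi>(1))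
    have "AE x in ?M. \<psi> x t (z x) = \<phi> x (z x)" for z
      using \<phi>(2) by eventually_elim simp
    then have "Psi \<Gamma> \<psi> t = functional"
      unfolding Psi_def by (intro ext M.integral_cong_AE_complete)
    moreover have "AE x in ?M. clarke_deriv (\<psi> x t) (z x) (w x) = clarke_deriv (\<phi> x) (z x) (w x)" for z w
      using \<phi>(2) by eventually_elim simp
    then have "(\<integral>x. clarke_deriv (\<psi> x t) (z x) (w x) \<partial>?M) = (\<integral>x. clarke_deriv (\<phi> x) (z x) (w x) \<partial>?M)" for z w
      by (intro M.integral_cong_AE_complete)
    ultimately show ?case
      unfolding Psi_deriv_def using clarke_deriv_functional_le by simp
  qed
qed

section \<open>Comparison of the two problems\<close>

lemma borel_imp_surface_measure:
  assumes "CARD('n) \<ge> 2" and "A \<in> sets borel"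
  shows "A \<in> sets (surface_measure :: (real^'n) measure)"
  using assms borel_subset_surface_measure[where 'n='n] by blast

lemma finite_measure_surface_on:
  fixes \<Omega> :: "(real^'n) set"
  assumes card: "CARD('n) \<ge> 2" and dom: "bounded_lipschitz_domain \<Omega>"
    and \<Gamma>: "\<Gamma> \<in> sets borel" "\<Gamma> \<subseteq> frontier \<Omega>"
  shows "finite_measure (surface_on \<Gamma>)"
proof (rule finite_measureI)
  have "\<Gamma> \<in> sets surface_measure" using borel_imp_surface_measure[OF card \<Gamma>(1)] .
  then have "emeasure (surface_on \<Gamma>) (space (surface_on \<Gamma>)) = hausdorff_outer (CARD('n) - 1) \<Gamma>"
    unfolding surface_on_def
    by (simp add: emeasure_restrict_space space_restrict_space space_surface_measure surface_measure_facts(2)[OF card])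
  also have "\<dots> \<le> hausdorff_outer (CARD('n) - 1) (frontier \<Omega>)"
    using card by (intro hausdorff_outer_mono \<Gamma>) simp
  also have "\<dots> < \<infinity>" by (rule hausdorff_outer_lipschitz_frontier[OF card dom])
  finally show "emeasure (surface_on \<Gamma>) (space (surface_on \<Gamma>)) \<noteq> \<infinity>" by simp
qed

lemma complete_measure_surface_on:
  fixes \<Gamma> :: "(real^'n) set"
  assumes card: "CARD('n) \<ge> 2" and \<Gamma>: "\<Gamma> \<in> sets borel"
  shows "complete_measure (surface_on \<Gamma>)"
proof
  interpret complete_measure "surface_measure :: (real^'n) measure"
    using card by (rule complete_surface_measure)
  have meas: "\<Gamma> \<in> sets surface_measure" using borel_imp_surface_measure[OF card \<Gamma>] .
  fix A B assume "B \<subseteq> A" "A \<in> null_sets (surface_on \<Gamma>)"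
  then have "B \<in> null_sets (surface_on \<Gamma>)"
    unfolding surface_on_def null_sets_restrict_space[OF meas] by (blast intro: complete2)
  then show "B \<in> sets (surface_on \<Gamma>)" by blast
qed

lemma L2_surface_on_subset:
  fixes \<Gamma> :: "(real^'n) set"
  assumes card: "CARD('n) \<ge> 2" and \<Gamma>: "\<Gamma> \<in> sets borel" "\<Gamma> \<subseteq> \<Gamma>'" "\<Gamma>' \<in> sets borel"
    and g: "g \<in> L2 (surface_on \<Gamma>')"
  shows "g \<in> L2 (surface_on \<Gamma>)"
proof -
  let ?M = "surface_measure :: (real^'n) measure"
  have sets: "\<Gamma> \<in> sets ?M" "\<Gamma>' \<in> sets ?M"
    using borel_imp_surface_measure[OF card] \<Gamma> by auto
  have "g \<in> borel_measurable (surface_on \<Gamma>)"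
    using g \<Gamma>(2) unfolding L2_def surface_on_def by (auto intro: measurable_restrict_mono)
  moreover have "set_integrable ?M \<Gamma>' (\<lambda>x. (norm (g x))\<^sup>2)"
    using g sets(2) unfolding L2_def surface_on_def set_integrable_def
    by (simp add: integrable_restrict_space space_surface_measure)
  then have "set_integrable ?M \<Gamma> (\<lambda>x. (norm (g x))\<^sup>2)"
    using sets(1) \<Gamma>(2) by (rule set_integrable_subset)
  then have "integrable (surface_on \<Gamma>) (\<lambda>x. (norm (g x))\<^sup>2)"
    using sets(1) unfolding surface_on_def set_integrable_def
    by (simp add: integrable_restrict_space space_surface_measure)
  ultimately show ?thesis by (simp add: L2_def)
qed

lemma outward_normal_surface_measurable:
  fixes \<Omega> :: "(real^'n) set"
  assumes "CARD('n) \<ge> 2"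
  shows "outward_normal \<Omega> \<in> borel_measurable (surface_on \<Gamma>)"
proof -
  have "outward_normal \<Omega> \<in> borel_measurable surface_measure"
    using borel_subset_surface_measure[OF assms]
    by (rule borel_measurable_subalgebra[OF _ _ outward_normal_borel_measurable])
      (simp add: space_surface_measure)
  then show ?thesis unfolding surface_on_def by (rule measurable_restrict_space1)
qed

lemma tangential_trace_L2:
  fixes \<Omega> :: "(real^'n) set"
  assumes card: "CARD('n) \<ge> 2" and \<Gamma>: "\<Gamma> \<in> sets borel" "\<Gamma> \<subseteq> frontier \<Omega>"
    and v: "v \<in> V_space \<Omega> \<Gamma>\<^sub>D \<Gamma>\<^sub>S"
  shows "tangential_trace \<Omega> v \<in> L2 (surface_on \<Gamma>)"
proof -
  let ?M = "surface_on \<Gamma>" and ?g = "boundary_trace \<Omega> v" and ?n = "outward_normal \<Omega>"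
  have "\<exists>g. has_boundary_trace \<Omega> v g" using v unfolding V_space_def by blast
  then have "has_boundary_trace \<Omega> v ?g" unfolding boundary_trace_def by (rule someI_ex)
  then have "?g \<in> L2 (surface_on (frontier \<Omega>))" by (simp add: has_boundary_trace_def)
  then have g: "?g \<in> L2 ?M"
    using L2_surface_on_subset[OF card \<Gamma>] by (simp add: borel_closed)
  then have [measurable]: "?g \<in> borel_measurable ?M" by (simp add: L2_def)
  have [measurable]: "?n \<in> borel_measurable ?M" by (rule outward_normal_surface_measurable[OF card])
  have meas: "tangential_trace \<Omega> v \<in> borel_measurable ?M"
    unfolding tangential_trace_def by measurable
  have bound: "norm (tangential_trace \<Omega> v x) \<le> 2 * norm (?g x)" for x
  proof -
    have "\<bar>?g x \<bullet> ?n x\<bar> \<le> norm (?g x) * 1"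
      using norm_outward_normal_le[of \<Omega> x]
      by (intro order_trans[OF Cauchy_Schwarz_ineq2] mult_left_mono) auto
    then have "\<bar>?g x \<bullet> ?n x\<bar> * norm (?n x) \<le> norm (?g x) * 1"
      using norm_outward_normal_le[of \<Omega> x] by (intro mult_mono) auto
    then show ?thesis
      unfolding tangential_trace_def
      by (intro order_trans[OF norm_triangle_ineq4]) simp
  qed
  have "integrable ?M (\<lambda>x. (norm (tangential_trace \<Omega> v x))\<^sup>2)"
  proof (rule Bochner_Integration.integrable_bound)
    show "integrable ?M (\<lambda>x. 4 * (norm (?g x))\<^sup>2)" using g by (simp add: L2_def)
    show "(\<lambda>x. (norm (tangential_trace \<Omega> v x))\<^sup>2) \<in> borel_measurable ?M" using meas by measurable
    show "AE x in ?M. norm ((norm (tangential_trace \<Omega> v x))\<^sup>2) \<le> norm (4 * (norm (?g x))\<^sup>2)"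
      using power_mono[OF bound norm_ge_zero, of _ 2] by (intro AE_I2) (simp add: power_mult_distrib)
  qed
  then show ?thesis using meas by (simp add: L2_def)
qed

lemma solves_P'_imp_solves_P:
  fixes \<Omega> \<Gamma>\<^sub>D \<Gamma>\<^sub>S :: "(real^'n) set"
  assumes card: "CARD('n) \<ge> 2" and dom: "bounded_lipschitz_domain \<Omega>"
    and \<Gamma>: "\<Gamma>\<^sub>S \<in> sets borel" "\<Gamma>\<^sub>S \<subseteq> frontier \<Omega>" and sup: "superpotential \<Gamma>\<^sub>S T \<psi>"
    and sol: "solves_P' \<Omega> \<Gamma>\<^sub>D \<Gamma>\<^sub>S T \<mu> \<psi> f u\<^sub>0 u p"
  shows "solves_P \<Omega> \<Gamma>\<^sub>D \<Gamma>\<^sub>S T \<mu> \<psi> f u\<^sub>0 u p"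
proof -
  have "AE t in lebesgue_on {0<..<T}. u t \<in> V_space \<Omega> \<Gamma>\<^sub>D \<Gamma>\<^sub>S"
    using sol by (simp add: solves_P'_def WW_def VV_def bochner_L2_def)
  moreover note Psi_deriv_le_integral[OF finite_measure_surface_on[OF card dom \<Gamma>]
      complete_measure_surface_on[OF card \<Gamma>(1)] sup]
  moreover have "AE t in lebesgue_on {0<..<T}.
        (\<forall>v \<in> V_space \<Omega> \<Gamma>\<^sub>D \<Gamma>\<^sub>S.
           time_derivative \<Omega> \<Gamma>\<^sub>D \<Gamma>\<^sub>S T u t v + form_a \<Omega> \<mu> (u t) v - form_b \<Omega> v (p t)
             + Psi_deriv \<Gamma>\<^sub>S \<psi> t (tangential_trace \<Omega> (u t)) (tangential_trace \<Omega> v)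
           \<ge> f t v) \<and>
        (\<forall>q \<in> Q_space \<Omega>. form_b \<Omega> (u t) q = 0)"
    using sol by (simp add: solves_P'_def)
  ultimately have "AE t in lebesgue_on {0<..<T}.
        (\<forall>v \<in> V_space \<Omega> \<Gamma>\<^sub>D \<Gamma>\<^sub>S.
           time_derivative \<Omega> \<Gamma>\<^sub>D \<Gamma>\<^sub>S T u t v + form_a \<Omega> \<mu> (u t) v - form_b \<Omega> v (p t)
             + (\<integral>x. clarke_deriv (\<psi> x t) (tangential_trace \<Omega> (u t) x) (tangential_trace \<Omega> v x)
                  \<partial>surface_on \<Gamma>\<^sub>S)
           \<ge> f t v) \<and>
        (\<forall>q \<in> Q_space \<Omega>. form_b \<Omega> (u t) q = 0)"
  proof eventually_elim
    case (elim t)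
    show ?case
    proof (intro conjI ballI)
      fix v assume v: "v \<in> V_space \<Omega> \<Gamma>\<^sub>D \<Gamma>\<^sub>S"
      have "Psi_deriv \<Gamma>\<^sub>S \<psi> t (tangential_trace \<Omega> (u t)) (tangential_trace \<Omega> v)
          \<le> (\<integral>x. clarke_deriv (\<psi> x t) (tangential_trace \<Omega> (u t) x) (tangential_trace \<Omega> v x) \<partial>surface_on \<Gamma>\<^sub>S)"
        using elim(2) tangential_trace_L2[OF card \<Gamma> v] tangential_trace_L2[OF card \<Gamma> elim(1)] by blast
      moreover have "f t v \<le> time_derivative \<Omega> \<Gamma>\<^sub>D \<Gamma>\<^sub>S T u t v + form_a \<Omega> \<mu> (u t) v - form_b \<Omega> v (p t)
          + Psi_deriv \<Gamma>\<^sub>S \<psi> t (tangential_trace \<Omega> (u t)) (tangential_trace \<Omega> v)"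
        using elim(3) v by blast
      ultimately show "f t v \<le> time_derivative \<Omega> \<Gamma>\<^sub>D \<Gamma>\<^sub>S T u t v + form_a \<Omega> \<mu> (u t) v - form_b \<Omega> v (p t)
          + (\<integral>x. clarke_deriv (\<psi> x t) (tangential_trace \<Omega> (u t) x) (tangential_trace \<Omega> v x) \<partial>surface_on \<Gamma>\<^sub>S)"
        by linarith
    qed (use elim(3) in blast)
  qed
  then show ?thesis using sol by (simp add: solves_P_def solves_P'_def)
qed

theorem proposition3p8:
  fixes \<Omega> \<Gamma>\<^sub>D \<Gamma>\<^sub>S :: "(real^'n) set"
    and T \<mu> :: real
    and \<psi> :: "real^'n \<Rightarrow> real \<Rightarrow> real^'n \<Rightarrow> real"
    and f :: "real \<Rightarrow> (real^'n \<Rightarrow> real^'n) \<Rightarrow> real"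
    and u\<^sub>0 :: "real^'n \<Rightarrow> real^'n"
  assumes "CARD('n) \<in> {2, 3}"
    and "bounded_lipschitz_domain \<Omega>"
    and "frontier \<Omega> = \<Gamma>\<^sub>D \<union> \<Gamma>\<^sub>S" and "\<Gamma>\<^sub>D \<inter> \<Gamma>\<^sub>S = {}"
    and "closedin (top_of_set (frontier \<Omega>)) \<Gamma>\<^sub>D"
    and "openin (top_of_set (frontier \<Omega>)) \<Gamma>\<^sub>S"
    and "emeasure surface_measure \<Gamma>\<^sub>D > 0" and "emeasure surface_measure \<Gamma>\<^sub>S > 0"
    and "T > 0" and "\<mu> > 0"
    and "f \<in> VV_dual \<Omega> \<Gamma>\<^sub>D \<Gamma>\<^sub>S T"
    and "u\<^sub>0 \<in> L2 (lebesgue_on \<Omega>)"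
    and "superpotential \<Gamma>\<^sub>S T \<psi>"
  shows "(\<forall>u p. solves_P' \<Omega> \<Gamma>\<^sub>D \<Gamma>\<^sub>S T \<mu> \<psi> f u\<^sub>0 u p \<longrightarrow> solves_P \<Omega> \<Gamma>\<^sub>D \<Gamma>\<^sub>S T \<mu> \<psi> f u\<^sub>0 u p) \<and>
    ((\<exists>u p. solves_P' \<Omega> \<Gamma>\<^sub>D \<Gamma>\<^sub>S T \<mu> \<psi> f u\<^sub>0 u p) \<and>
     (\<forall>u\<^sub>1 p\<^sub>1 u\<^sub>2 p\<^sub>2. solves_P \<Omega> \<Gamma>\<^sub>D \<Gamma>\<^sub>S T \<mu> \<psi> f u\<^sub>0 u\<^sub>1 p\<^sub>1 \<and> solves_P \<Omega> \<Gamma>\<^sub>D \<Gamma>\<^sub>S T \<mu> \<psi> f u\<^sub>0 u\<^sub>2 p\<^sub>2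
        \<longrightarrow> same_solution \<Omega> T (u\<^sub>1, p\<^sub>1) (u\<^sub>2, p\<^sub>2))
     \<longrightarrow> (\<exists>u p. solves_P \<Omega> \<Gamma>\<^sub>D \<Gamma>\<^sub>S T \<mu> \<psi> f u\<^sub>0 u p \<and> solves_P' \<Omega> \<Gamma>\<^sub>D \<Gamma>\<^sub>S T \<mu> \<psi> f u\<^sub>0 u p \<and>
            (\<forall>u' p'. solves_P \<Omega> \<Gamma>\<^sub>D \<Gamma>\<^sub>S T \<mu> \<psi> f u\<^sub>0 u' p' \<longrightarrow> same_solution \<Omega> T (u', p') (u, p)) \<and>
            (\<forall>u' p'. solves_P' \<Omega> \<Gamma>\<^sub>D \<Gamma>\<^sub>S T \<mu> \<psi> f u\<^sub>0 u' p' \<longrightarrow> same_solution \<Omega> T (u', p') (u, p))))"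
proof -
  have card: "CARD('n) \<ge> 2" using assms(1) by auto
  obtain U where "open U" "\<Gamma>\<^sub>S = frontier \<Omega> \<inter> U"
    using assms(6) by (auto simp: openin_open)
  then have \<Gamma>: "\<Gamma>\<^sub>S \<in> sets borel" "\<Gamma>\<^sub>S \<subseteq> frontier \<Omega>"
    by (auto intro!: sets.Int borel_closed borel_open)
  have "solves_P \<Omega> \<Gamma>\<^sub>D \<Gamma>\<^sub>S T \<mu> \<psi> f u\<^sub>0 u p" if "solves_P' \<Omega> \<Gamma>\<^sub>D \<Gamma>\<^sub>S T \<mu> \<psi> f u\<^sub>0 u p" for u p
    using solves_P'_imp_solves_P[OF card assms(2) \<Gamma> assms(13) that] .
  then show ?thesis by blast
qed

end
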